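(* Assume $H_A$ holds with $F_*=\theta G+(1-\theta)F$, $0<\theta<1$. Suppose that, as $m\to\infty$, $m\theta^2|\mathfrak D_h(F,G)|\to\infty$, and that $\sigma|\mathfrak D_h(F,G)|^{-1/2}\to\zeta$ and $\sigma_*|\mathfrak D_h(F,G)|^{-1/2}\to\zeta_*$ for some $\zeta,\zeta_*>0$. Then, for either choice $\mathcal D_m(k)=\mathcal D^{(1)}_m(k)$ or $\mathcal D_m(k)=\mathcal D^{(2)}_m(k)$ of the detector and every constant $c>0$, $$\lim_{m\to\infty}P(\tau_m<\infty)=1.$$
   Context: $X_1,X_2,\ldots$ are independent random elements of a separable metric space $\mathcal X$, with $X_1,\ldots,X_m\sim F$ (historical sample). The kernel $h:\mathcal X\times\mathcal X\to\mathbb R$ is symmetric with $E h^2(X,Y)<\infty$ for i.i.d. $X,Y\sim F$. The alternative $H_A$: for some $k_*\ge1$, $X_{m+k}\sim F$ for $1\le k\le k_*$ and $X_{m+k}\sim F_*$ for $k\ge k_*+1$, where $F_*\ne F$. The quantities $k_*$, $\theta$ and $G$ (hence $F_*$) may depend on $m$. Put $$v(x)=\int h(x,y)\,d(F-G)(y),\qquad \mathfrak D_h(F,G)=\iint h(x,y)\,d(F-G)(x)\,d(F-G)(y),$$ $\sigma^2=\mathrm{var}(v(X))$ for $X\sim F$ and $\sigma_*^2=\mathrm{var}(v(X^* ))$ for $X^*\sim F_*$. All these integrals and variances are assumed to be well defined and finite. For $m,k\ge2$ and $0\le r<k-1$, $$U_m(h;r,k)=\frac{2}{(k-r)m}\sum_{i=1}^m\sum_{j=m+r+1}^{m+k}h(X_i,X_j)-\binom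 m2^{-1}\sum_{1\le i<j\le m}h(X_i,X_j)-\binom{k-r}2^{-1}\sum_{m+r<i<j\le m+k}h(X_i,X_j),$$ with the convention $U_m(h;k-1,k)=U_m(h;k-2,k)$. The detectors are $\mathcal D_m^{(1)}(k)=m^{-1}k^2|U_m(h;0,k)|$ and $\mathcal D_m^{(2)}(k)=m^{-1}\max_{0\le r<k}(k-r)^2|U_m(h;r,k)|$. The boundary is $g_m(k)=\left(\frac{k/m}{1+k/m}\right)^{\beta}\left(1+\frac km\right)^2$ with fixed $0\le\beta<1$, and $\tau_m=\min\{k\ge2:\mathcal D_m(k)>c\,g_m(k)\}$, with $\tau_m=\infty$ if there is no such $k$. *)

theory Defs
  imports "HOL-Probability.Probability" "HOL-Library.Extended_Nat"
begin

text \<open>Integration against the signed measure \<open>F - G\<close>. The two integrals are split, so this is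
  meaningful when \<open>f\<close> is integrable with respect to both \<open>F\<close> and \<open>G\<close>.\<close>

definition diff_integral :: "'a measure \<Rightarrow> 'a measure \<Rightarrow> ('a \<Rightarrow> real) \<Rightarrow> real" where
  "diff_integral F G f = (\<integral>x. f x \<partial>F) - (\<integral>x. f x \<partial>G)"

definition kernel_proj :: "('a \<Rightarrow> 'a \<Rightarrow> real) \<Rightarrow> 'a measure \<Rightarrow> 'a measure \<Rightarrow> 'a \<Rightarrow> real" where
  "kernel_proj h F G x = diff_integral F G (\<lambda>y. h x y)"

definition kernel_dist :: "('a \<Rightarrow> 'a \<Rightarrow> real) \<Rightarrow> 'a measure \<Rightarrow> 'a measure \<Rightarrow> real" where
  "kernel_dist h F G = diff_integral F G (\<lambda>y. diff_integral F G (\<lambda>x. h x y))"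

text \<open>In the statistics below, \<open>x 1, \<dots>, x m\<close> is the historical sample and
  \<open>x (m + 1), x (m + 2), \<dots>\<close> are the monitored observations. The formula in
  \<open>ustat_core\<close> is the intended one for \<open>r + 1 < k\<close>; the boundary case \<open>r = k - 1\<close> is
  replaced by \<open>r = k - 2\<close> in \<open>ustat\<close>.\<close>

definition ustat_core ::
  "('a \<Rightarrow> 'a \<Rightarrow> real) \<Rightarrow> (nat \<Rightarrow> 'a) \<Rightarrow> nat \<Rightarrow> nat \<Rightarrow> nat \<Rightarrow> real" where
  "ustat_core h x m r k =
     2 / (real (k - r) * real m) * (\<Sum>i\<in>{1..m}. \<Sum>j\<in>{m+r+1..m+k}. h (x i) (x j))
     - 1 / real (m choose 2) * (\<Sum>(i, j)\<in>{(i, j). 1 \<le> i \<and> i < j \<and> j \<le> m}. h (x i) (x j))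
     - 1 / real ((k - r) choose 2)
         * (\<Sum>(i, j)\<in>{(i, j). m + r < i \<and> i < j \<and> j \<le> m + k}. h (x i) (x j))"

definition ustat ::
  "('a \<Rightarrow> 'a \<Rightarrow> real) \<Rightarrow> (nat \<Rightarrow> 'a) \<Rightarrow> nat \<Rightarrow> nat \<Rightarrow> nat \<Rightarrow> real" where
  "ustat h x m r k = (if r = k - 1 then ustat_core h x m (k - 2) k else ustat_core h x m r k)"

definition detector1 :: "('a \<Rightarrow> 'a \<Rightarrow> real) \<Rightarrow> (nat \<Rightarrow> 'a) \<Rightarrow> nat \<Rightarrow> nat \<Rightarrow> real" where
  "detector1 h x m k = 1 / real m * (real k)\<^sup>2 * \<bar>ustat h x m 0 k\<bar>"

definition detector2 :: "('a \<Rightarrow> 'a \<Rightarrow> real) \<Rightarrow> (nat \<Rightarrow> 'a) \<Rightarrow> nat \<Rightarrow> nat \<Rightarrow> real" where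
  "detector2 h x m k =
     1 / real m * Max ((\<lambda>r. (real (k - r))\<^sup>2 * \<bar>ustat h x m r k\<bar>) ` {0..<k})"

definition boundary :: "real \<Rightarrow> nat \<Rightarrow> nat \<Rightarrow> real" where
  "boundary \<beta> m k =
     ((real k / real m) / (1 + real k / real m)) powr \<beta> * (1 + real k / real m)\<^sup>2"

definition stop_time :: "real \<Rightarrow> real \<Rightarrow> nat \<Rightarrow> (nat \<Rightarrow> real) \<Rightarrow> enat" where
  "stop_time c \<beta> m D =
     (if \<exists>k\<ge>2. D k > c * boundary \<beta> m k
      then enat (LEAST k. 2 \<le> k \<and> D k > c * boundary \<beta> m k)
      else \<infinity>)"

text \<open>\<open>Q\<close> is the mixture \<open>\<theta> G + (1 - \<theta>) F\<close>, as an identity of Borel measures.\<close>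

definition is_mixture ::
  "real \<Rightarrow> 'a measure \<Rightarrow> 'a measure \<Rightarrow> ('a::topological_space) measure \<Rightarrow> bool" where
  "is_mixture \<theta> G F Q \<longleftrightarrow>
     (\<forall>A\<in>sets borel. measure Q A = \<theta> * measure G A + (1 - \<theta>) * measure F A)"

definition borel_prob :: "('a::topological_space) measure \<Rightarrow> bool" where
  "borel_prob P \<longleftrightarrow> prob_space P \<and> sets P = sets borel"

text \<open>The alternative for training size \<open>m\<close>: the law is \<open>F\<close> up to and including index
  \<open>m + kst\<close>, and \<open>Fs \<noteq> F\<close> afterwards. Index \<open>0\<close> of the sequence is not used.\<close>

definition change_model ::
  "'w measure \<Rightarrow> (nat \<Rightarrow> 'w \<Rightarrow> 'a) \<Rightarrow> nat \<Rightarrow> nat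
     \<Rightarrow> ('a::topological_space) measure \<Rightarrow> 'a measure \<Rightarrow> bool" where
  "change_model M X m kst F Fs \<longleftrightarrow>
     prob_space M \<and> prob_space.indep_vars M (\<lambda>_. borel) X {1..} \<and>
     (\<forall>i\<in>{1..m}. distr M borel (X i) = F) \<and>
     1 \<le> kst \<and>
     (\<forall>k. 1 \<le> k \<and> k \<le> kst \<longrightarrow> distr M borel (X (m + k)) = F) \<and>
     (\<forall>k. k \<ge> kst + 1 \<longrightarrow> distr M borel (X (m + k)) = Fs) \<and>
     Fs \<noteq> F"

end

theory Submission
  imports Defs "HOL-Real_Asymp.Real_Asymp"
begin

text \<open>For fixed \<open>m\<close>, let \<open>k\<close> tend to infinity. The finitely many observations before the change
  become negligible, so \<open>U\<^sub>m(h;0,k)\<close> converges in \<open>L\<^sup>1\<close> to a function \<open>L\<^sub>m\<close> of the historical sample;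
  since \<open>h\<close> is only integrable under the law after the change, this needs a truncation argument.
  As \<open>g\<^sub>m(k) \<le> 4k\<^sup>2/m\<^sup>2\<close> for \<open>k \<ge> m\<close>, the first detector stops as soon as \<open>m\<bar>L\<^sub>m\<bar> > 4c\<close> with a
  margin, and the second detector dominates the first one. Finally
  \<open>m L\<^sub>m = - R\<^sub>m - m\<theta>\<^sup>2 D\<close> with \<open>D\<close> the kernel distance, where \<open>R\<^sub>m\<close> is the sum of a canonical U-statistic of
  bounded variance and of a centered sum of variance \<open>O(m\<theta>\<^sup>2 \<bar>D\<bar>)\<close>. Because \<open>m\<theta>\<^sup>2 \<bar>D\<bar>\<close> tends to infinity,
  Chebyshev's inequality gives \<open>m\<bar>L\<^sub>m\<bar> \<rightarrow> \<infinity>\<close> in probability.\<close>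

section \<open>Second moments and truncation\<close>

text \<open>The two kinds of hypotheses on the kernel dictate two kinds of estimates. A second
  moment is given under the law of two historical observations, so the historical sample can be
  treated by variances. Under the laws that involve G only first moments are given, so everything
  after the change is treated in L^1: the kernel is cut off at a finite level, the cut kernel is
  recentred, and each term costs \<epsilon>. No rate in k is needed. Detection asks for a single
  successful k, so k may go to infinity for each m separately. The position of the change, which may
  vary arbitrarily with m, disappears in that limit, and r = 0 suffices. Only the fluctuation of the
  limit has to be bounded uniformly in m. Its degenerate part depends on the fixed F alone, which
  gives a bound free of m. Its linear part has variance at most of order q = m \<theta>^2 |D|, by
  the assumption on \<sigma>. Chebyshev's inequality then bounds the failure probability by a
  constant times (1 + q) / (q - 4c - 1)^2.\<close>

lemma (in prob_space) expectation_abs_le_sqrt: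
  fixes Z :: "'a \<Rightarrow> real"
  assumes [measurable]: "Z \<in> borel_measurable M" and Z2: "integrable M (\<lambda>\<omega>. (Z \<omega>)\<^sup>2)"
  shows "integrable M Z" "expectation (\<lambda>\<omega>. \<bar>Z \<omega>\<bar>) \<le> sqrt (expectation (\<lambda>\<omega>. (Z \<omega>)\<^sup>2))"
proof -
  show int: "integrable M Z"
    by (rule square_integrable_imp_integrable[OF _ Z2]) simp
  \<comment> \<open>Jensen's inequality, read off from the nonnegativity of the variance of
    |Z|.\<close>
  have "variance (\<lambda>\<omega>. \<bar>Z \<omega>\<bar>) = expectation (\<lambda>\<omega>. \<bar>Z \<omega>\<bar>\<^sup>2) - (expectation (\<lambda>\<omega>. \<bar>Z \<omega>\<bar>))\<^sup>2"
    using int Z2 by (intro variance_eq) auto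
  with variance_positive[of "\<lambda>\<omega>. \<bar>Z \<omega>\<bar>"]
  show "expectation (\<lambda>\<omega>. \<bar>Z \<omega>\<bar>) \<le> sqrt (expectation (\<lambda>\<omega>. (Z \<omega>)\<^sup>2))"
    by (intro real_le_rsqrt) auto
qed

lemma integrable_mult_of_squares:
  fixes Y Z :: "'a \<Rightarrow> real"
  assumes [measurable]: "Y \<in> borel_measurable M" "Z \<in> borel_measurable M"
    and "integrable M (\<lambda>\<omega>. (Y \<omega>)\<^sup>2)" "integrable M (\<lambda>\<omega>. (Z \<omega>)\<^sup>2)"
  shows "integrable M (\<lambda>\<omega>. Y \<omega> * Z \<omega>)"
proof (rule Bochner_Integration.integrable_bound)
  show "integrable M (\<lambda>\<omega>. (Y \<omega>)\<^sup>2 + (Z \<omega>)\<^sup>2)" using assms by auto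
  show "AE \<omega> in M. norm (Y \<omega> * Z \<omega>) \<le> norm ((Y \<omega>)\<^sup>2 + (Z \<omega>)\<^sup>2)"
  proof (intro AE_I2)
    fix \<omega>
    have "2 * (\<bar>Y \<omega>\<bar> * \<bar>Z \<omega>\<bar>) \<le> (Y \<omega>)\<^sup>2 + (Z \<omega>)\<^sup>2"
      using sum_squares_bound[of "\<bar>Y \<omega>\<bar>" "\<bar>Z \<omega>\<bar>"] by (simp add: mult.assoc)
    moreover have "0 \<le> \<bar>Y \<omega>\<bar> * \<bar>Z \<omega>\<bar>" by simp
    ultimately show "norm (Y \<omega> * Z \<omega>) \<le> norm ((Y \<omega>)\<^sup>2 + (Z \<omega>)\<^sup>2)"
      by (simp only: real_norm_def abs_mult)
  qed
qed simp

lemma integral_mult_le_of_squares: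
  fixes Y Z :: "'a \<Rightarrow> real"
  assumes [measurable]: "Y \<in> borel_measurable M" "Z \<in> borel_measurable M"
    and int: "integrable M (\<lambda>\<omega>. (Y \<omega>)\<^sup>2)" "integrable M (\<lambda>\<omega>. (Z \<omega>)\<^sup>2)"
    and le: "(\<integral>\<omega>. (Y \<omega>)\<^sup>2 \<partial>M) \<le> C" "(\<integral>\<omega>. (Z \<omega>)\<^sup>2 \<partial>M) \<le> C"
  shows "(\<integral>\<omega>. Y \<omega> * Z \<omega> \<partial>M) \<le> C"
proof -
  have "(\<integral>\<omega>. Y \<omega> * Z \<omega> \<partial>M) \<le> (\<integral>\<omega>. ((Y \<omega>)\<^sup>2 + (Z \<omega>)\<^sup>2) / 2 \<partial>M)"
    using integrable_mult_of_squares[OF assms(1-4)] int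
  proof (intro integral_mono)
    fix \<omega>
    show "Y \<omega> * Z \<omega> \<le> ((Y \<omega>)\<^sup>2 + (Z \<omega>)\<^sup>2) / 2"
      using sum_squares_bound[of "Y \<omega>" "Z \<omega>"] by (simp add: field_simps)
  qed auto
  also have "\<dots> = ((\<integral>\<omega>. (Y \<omega>)\<^sup>2 \<partial>M) + (\<integral>\<omega>. (Z \<omega>)\<^sup>2 \<partial>M)) / 2"
    using int by simp
  finally show ?thesis using le by simp
qed

text \<open>Expanding the square gives the sum over T x T of all mixed moments. Each row has at most
  N nonzero entries, and each of these is at most C by \<open>integral_mult_le_of_squares\<close>. N
  = 1 is the orthogonal case; a larger N serves for index pairs that interact when they share an
  index.\<close>

lemma second_moment_sum_sparse:
  fixes Z :: "'i \<Rightarrow> 'a \<Rightarrow> real"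
  assumes fin: "finite T"
    and meas: "\<And>t. t \<in> T \<Longrightarrow> Z t \<in> borel_measurable M"
    and sq: "\<And>t. t \<in> T \<Longrightarrow> integrable M (\<lambda>\<omega>. (Z t \<omega>)\<^sup>2)"
    and le: "\<And>t. t \<in> T \<Longrightarrow> (\<integral>\<omega>. (Z t \<omega>)\<^sup>2 \<partial>M) \<le> C"
    and sparse: "\<And>s. s \<in> T \<Longrightarrow> card {t \<in> T. (\<integral>\<omega>. Z s \<omega> * Z t \<omega> \<partial>M) \<noteq> 0} \<le> N"
  shows "integrable M (\<lambda>\<omega>. (\<Sum>t\<in>T. Z t \<omega>)\<^sup>2)"
    and "(\<integral>\<omega>. (\<Sum>t\<in>T. Z t \<omega>)\<^sup>2 \<partial>M) \<le> real (card T) * real N * C"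
proof -
  have eq: "(\<Sum>t\<in>T. Z t \<omega>)\<^sup>2 = (\<Sum>s\<in>T. \<Sum>t\<in>T. Z s \<omega> * Z t \<omega>)" for \<omega>
    by (simp add: power2_eq_square sum_product)
  have int: "integrable M (\<lambda>\<omega>. Z s \<omega> * Z t \<omega>)" if "s \<in> T" "t \<in> T" for s t
    using that meas sq by (intro integrable_mult_of_squares) auto
  show "integrable M (\<lambda>\<omega>. (\<Sum>t\<in>T. Z t \<omega>)\<^sup>2)"
    unfolding eq using int by auto
  have "(\<integral>\<omega>. (\<Sum>t\<in>T. Z t \<omega>)\<^sup>2 \<partial>M) = (\<Sum>s\<in>T. \<Sum>t\<in>T. \<integral>\<omega>. Z s \<omega> * Z t \<omega> \<partial>M)"
    unfolding eq using int by (simp add: Bochner_Integration.integral_sum Bochner_Integration.integrable_sum)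
  also have "\<dots> \<le> (\<Sum>s\<in>T. real N * C)"
  proof (rule sum_mono)
    fix s assume s: "s \<in> T"
    let ?E = "{t \<in> T. (\<integral>\<omega>. Z s \<omega> * Z t \<omega> \<partial>M) \<noteq> 0}"
    have "0 \<le> (\<integral>\<omega>. (Z s \<omega>)\<^sup>2 \<partial>M)" by (rule integral_nonneg_AE) simp
    with le[OF s] have C: "0 \<le> C" by linarith
    have "(\<Sum>t\<in>T. \<integral>\<omega>. Z s \<omega> * Z t \<omega> \<partial>M) = (\<Sum>t\<in>?E. \<integral>\<omega>. Z s \<omega> * Z t \<omega> \<partial>M)"
      using fin by (intro sum.mono_neutral_right) auto
    also have "\<dots> \<le> (\<Sum>t\<in>?E. C)"
      using s meas sq le by (intro sum_mono integral_mult_le_of_squares) auto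
    also have "\<dots> = real (card ?E) * C" by simp
    also have "\<dots> \<le> real N * C" using sparse[OF s] C by (intro mult_right_mono) auto
    finally show "(\<Sum>t\<in>T. \<integral>\<omega>. Z s \<omega> * Z t \<omega> \<partial>M) \<le> real N * C" .
  qed
  finally show "(\<integral>\<omega>. (\<Sum>t\<in>T. Z t \<omega>)\<^sup>2 \<partial>M) \<le> real (card T) * real N * C"
    by (simp add: mult.assoc)
qed

text \<open>For sums whose terms \<open>D t\<close> may lack second moments. The terms in
  \<open>B\<close> are estimated one by one, the others are replaced by square integrable
  \<open>Z t\<close> at cost \<epsilon> each, and the sum of the \<open>Z t\<close> is handled by
  its second moment. Later \<open>B\<close> collects the terms with a monitored observation from
  before the change.\<close>

lemma (in prob_space) expectation_abs_sum_le:
  fixes D Z :: "'i \<Rightarrow> 'a \<Rightarrow> real"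
  assumes fin: "finite T" and B: "B \<subseteq> T"
    and int: "\<And>t. t \<in> T \<Longrightarrow> integrable M (D t)"
    and K: "\<And>t. t \<in> B \<Longrightarrow> expectation (\<lambda>\<omega>. \<bar>D t \<omega>\<bar>) \<le> K"
    and \<epsilon>: "\<And>t. t \<in> T - B \<Longrightarrow> expectation (\<lambda>\<omega>. \<bar>D t \<omega> - Z t \<omega>\<bar>) \<le> \<epsilon>" "0 \<le> \<epsilon>"
    and meas: "\<And>t. t \<in> T - B \<Longrightarrow> Z t \<in> borel_measurable M"
    and sq: "\<And>t. t \<in> T - B \<Longrightarrow> integrable M (\<lambda>\<omega>. (Z t \<omega>)\<^sup>2)"
    and le: "\<And>t. t \<in> T - B \<Longrightarrow> expectation (\<lambda>\<omega>. (Z t \<omega>)\<^sup>2) \<le> C" "0 \<le> C"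
    and sparse: "\<And>s. s \<in> T - B \<Longrightarrow> card {t \<in> T - B. expectation (\<lambda>\<omega>. Z s \<omega> * Z t \<omega>) \<noteq> 0} \<le> N"
  shows "expectation (\<lambda>\<omega>. \<bar>\<Sum>t\<in>T. D t \<omega>\<bar>)
    \<le> real (card B) * K + real (card T) * \<epsilon> + sqrt (real (card T) * real N * C)"
proof -
  let ?S = "\<lambda>\<omega>. \<Sum>t\<in>T - B. Z t \<omega>"
  have intZ: "integrable M (Z t)" if "t \<in> T - B" for t
    using meas[OF that] sq[OF that] by (rule expectation_abs_le_sqrt(1))
  have finTB: "finite (T - B)" using fin by simp
  note S = second_moment_sum_sparse[where Z=Z and T="T - B" and M=M and C=C and N=N, OF finTB meas sq le(1) sparse]
  have "expectation (\<lambda>\<omega>. \<bar>?S \<omega>\<bar>) \<le> sqrt (expectation (\<lambda>\<omega>. (?S \<omega>)\<^sup>2))"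
    using meas S(1) by (intro expectation_abs_le_sqrt(2)) auto
  also have "\<dots> \<le> sqrt (real (card T) * real N * C)"
  proof (rule real_sqrt_le_mono, rule order_trans[OF S(2)])
    show "real (card (T - B)) * real N * C \<le> real (card T) * real N * C"
      using fin le(2) by (intro mult_right_mono) (auto intro: card_mono)
  qed
  finally have bS: "expectation (\<lambda>\<omega>. \<bar>?S \<omega>\<bar>) \<le> sqrt (real (card T) * real N * C)" .
  have "expectation (\<lambda>\<omega>. \<bar>\<Sum>t\<in>T. D t \<omega>\<bar>) \<le>
      expectation (\<lambda>\<omega>. (\<Sum>t\<in>B. \<bar>D t \<omega>\<bar>) + (\<Sum>t\<in>T - B. \<bar>D t \<omega> - Z t \<omega>\<bar>) + \<bar>?S \<omega>\<bar>)"
  proof (rule integral_mono)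
    show "integrable M (\<lambda>\<omega>. \<bar>\<Sum>t\<in>T. D t \<omega>\<bar>)" using int by auto
    show "integrable M (\<lambda>\<omega>. (\<Sum>t\<in>B. \<bar>D t \<omega>\<bar>) + (\<Sum>t\<in>T - B. \<bar>D t \<omega> - Z t \<omega>\<bar>) + \<bar>?S \<omega>\<bar>)"
      using int intZ B
      by (intro Bochner_Integration.integrable_add Bochner_Integration.integrable_sum
          integrable_abs Bochner_Integration.integrable_diff) auto
    fix \<omega>
    have "(\<Sum>t\<in>T. D t \<omega>) = (\<Sum>t\<in>B. D t \<omega>) + (\<Sum>t\<in>T - B. D t \<omega> - Z t \<omega>) + ?S \<omega>"
      using sum.subset_diff[OF B fin, of "\<lambda>t. D t \<omega>"] by (simp add: sum_subtractf)
    also have "\<bar>\<dots>\<bar> \<le> \<bar>\<Sum>t\<in>B. D t \<omega>\<bar> + \<bar>\<Sum>t\<in>T - B. D t \<omega> - Z t \<omega>\<bar> + \<bar>?S \<omega>\<bar>"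
      by linarith
    also have "\<dots> \<le> (\<Sum>t\<in>B. \<bar>D t \<omega>\<bar>) + (\<Sum>t\<in>T - B. \<bar>D t \<omega> - Z t \<omega>\<bar>) + \<bar>?S \<omega>\<bar>"
      by (intro add_mono sum_abs order_refl)
    finally show "\<bar>\<Sum>t\<in>T. D t \<omega>\<bar> \<le> (\<Sum>t\<in>B. \<bar>D t \<omega>\<bar>) + (\<Sum>t\<in>T - B. \<bar>D t \<omega> - Z t \<omega>\<bar>) + \<bar>?S \<omega>\<bar>" .
  qed
  also have "\<dots> = (\<Sum>t\<in>B. expectation (\<lambda>\<omega>. \<bar>D t \<omega>\<bar>))
      + (\<Sum>t\<in>T - B. expectation (\<lambda>\<omega>. \<bar>D t \<omega> - Z t \<omega>\<bar>)) + expectation (\<lambda>\<omega>. \<bar>?S \<omega>\<bar>)"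
  proof -
    have 1: "integrable M (\<lambda>\<omega>. \<bar>D t \<omega>\<bar>)" if "t \<in> B" for t using int B that by auto
    have 2: "integrable M (\<lambda>\<omega>. \<bar>D t \<omega> - Z t \<omega>\<bar>)" if "t \<in> T - B" for t
      using int intZ that by auto
    have 3: "integrable M (\<lambda>\<omega>. \<bar>?S \<omega>\<bar>)"
      using intZ by (intro integrable_abs Bochner_Integration.integrable_sum) auto
    show ?thesis
      using 1 2 3
      by (simp only: Bochner_Integration.integral_add Bochner_Integration.integral_sum
          Bochner_Integration.integrable_add Bochner_Integration.integrable_sum)
  qed
  also have "\<dots> \<le> (\<Sum>t\<in>B. K) + (\<Sum>t\<in>T - B. \<epsilon>) + sqrt (real (card T) * real N * C)"
    using K \<epsilon> bS by (intro add_mono sum_mono) auto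
  also have "\<dots> \<le> real (card B) * K + real (card T) * \<epsilon> + sqrt (real (card T) * real N * C)"
    using fin \<epsilon>(2) by (auto intro!: mult_right_mono card_mono)
  finally show ?thesis .
qed

section \<open>Truncation in L^1\<close>

definition truncate :: "nat \<Rightarrow> real \<Rightarrow> real" where
  "truncate n z = (if \<bar>z\<bar> \<le> real n then z else 0)"

lemma truncate_measurable [measurable]: "truncate n \<in> borel_measurable borel"
  unfolding truncate_def by measurable

lemma abs_truncate_le: "\<bar>truncate n z\<bar> \<le> real n"
  by (simp add: truncate_def)

text \<open>Dominated convergence with majorant |f|: at each point the truncation is eventually the
  identity.\<close>

lemma truncate_approx:
  assumes f: "integrable M f" and "0 < \<epsilon>"
  shows "\<exists>n. (\<integral>x. \<bar>f x - truncate n (f x)\<bar> \<partial>M) < \<epsilon>"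
proof -
  have [measurable]: "f \<in> borel_measurable M" using f by auto
  have "(\<lambda>n. \<integral>x. \<bar>f x - truncate n (f x)\<bar> \<partial>M) \<longlonglongrightarrow> (\<integral>x. 0 \<partial>M)"
  proof (rule integral_dominated_convergence[where w="\<lambda>x. \<bar>f x\<bar>"])
    show "AE x in M. (\<lambda>n. \<bar>f x - truncate n (f x)\<bar>) \<longlonglongrightarrow> 0"
    proof (intro AE_I2 tendsto_eventually)
      fix x
      have "\<forall>\<^sub>F n in sequentially. \<bar>f x\<bar> \<le> real n"
        using filterlim_real_sequentially by (auto simp: filterlim_at_top)
      then show "\<forall>\<^sub>F n in sequentially. \<bar>f x - truncate n (f x)\<bar> = 0"
        by eventually_elim (simp add: truncate_def)
    qed
  qed (use f in \<open>auto simp: truncate_def\<close>)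
  then have "\<forall>\<^sub>F n in sequentially. (\<integral>x. \<bar>f x - truncate n (f x)\<bar> \<partial>M) < \<epsilon>"
    using \<open>0 < \<epsilon>\<close> by (intro order_tendstoD(2)[of _ 0]) auto
  then show ?thesis by (auto simp: eventually_sequentially)
qed

section \<open>Independence and orthogonality\<close>

text \<open>Fubini for the joint law, which is a product: the inner integral over \<open>Y\<close>
  is 0 for almost every value of \<open>W\<close>.\<close>

lemma (in prob_space) expectation_indep_eq_0:
  fixes g :: "'b \<times> 'b \<Rightarrow> real"
  assumes ind: "indep_var S W T Y"
    and g [measurable]: "g \<in> borel_measurable (S \<Otimes>\<^sub>M T)"
    and zero: "AE \<omega> in M. (\<integral>y. g (W \<omega>, y) \<partial>distr M T Y) = 0"
  shows "expectation (\<lambda>\<omega>. g (W \<omega>, Y \<omega>)) = 0"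
proof (cases "integrable M (\<lambda>\<omega>. g (W \<omega>, Y \<omega>))")
  case True
  from ind have rv [measurable]: "random_variable S W" "random_variable T Y"
    and eq: "distr M S W \<Otimes>\<^sub>M distr M T Y = distr M (S \<Otimes>\<^sub>M T) (\<lambda>\<omega>. (W \<omega>, Y \<omega>))"
    unfolding indep_var_distribution_eq by auto
  interpret W: prob_space "distr M S W" by (rule prob_space_distr) fact
  interpret Y: prob_space "distr M T Y" by (rule prob_space_distr) fact
  interpret P: pair_prob_space "distr M S W" "distr M T Y" ..
  have int: "integrable (distr M S W \<Otimes>\<^sub>M distr M T Y) g"
    unfolding eq using True by (simp add: integrable_distr_eq)
  have "expectation (\<lambda>\<omega>. g (W \<omega>, Y \<omega>)) = (\<integral>z. g z \<partial>(distr M S W \<Otimes>\<^sub>M distr M T Y))"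
    unfolding eq by (simp add: integral_distr)
  also have "\<dots> = (\<integral>w. (\<integral>y. g (w, y) \<partial>distr M T Y) \<partial>distr M S W)"
    using P.integral_fst'[OF int] by simp
  also have "\<dots> = expectation (\<lambda>\<omega>. \<integral>y. g (W \<omega>, y) \<partial>distr M T Y)"
    by (rule integral_distr) (use rv in measurable)
  also have "\<dots> = 0"
    using zero by (simp add: integral_eq_zero_AE)
  finally show ?thesis .
qed (rule not_integrable_integral_eq)

text \<open>No integrability appears in the hypotheses because the integral of a non-integrable function
  is \<open>0\<close>.\<close>

lemma (in prob_space) expectation_orthogonal:
  fixes f :: "'b \<times> 'b \<Rightarrow> real" and \<psi> :: "'b \<times> 'b \<Rightarrow> real"
  assumes ind: "indep_vars (\<lambda>_. N) X I" and I: "p \<in> I" "q \<in> I - {p}" "i \<in> I - {p}" "j \<in> I - {p}"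
    and f [measurable]: "f \<in> borel_measurable (N \<Otimes>\<^sub>M N)"
    and \<psi> [measurable]: "\<psi> \<in> borel_measurable (N \<Otimes>\<^sub>M N)"
    and zero: "AE \<omega> in M. (\<integral>y. f (X q \<omega>, y) \<partial>distr M N (X p)) = 0"
  shows "expectation (\<lambda>\<omega>. f (X q \<omega>, X p \<omega>) * \<psi> (X i \<omega>, X j \<omega>)) = 0"
proof -
  \<comment> \<open>The indices \<open>q\<close>, \<open>i\<close>, \<open>j\<close> may coincide,
    hence a set. Only \<open>p\<close> must stay outside it, so that \<open>X p\<close> is
    independent of the whole block.\<close>
  let ?A = "{q, i, j}"
  let ?W = "\<lambda>\<omega>. restrict (\<lambda>i. X i \<omega>) ?A"
  let ?Y = "\<lambda>\<omega>. restrict (\<lambda>i. X i \<omega>) {p}"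
  let ?N = "\<lambda>_. N"
  let ?g = "\<lambda>z. f (fst z q, snd z p) * \<psi> (fst z i, fst z j)"
  have X [measurable]: "X p \<in> measurable M N" "X q \<in> measurable M N"
    using ind I by (auto simp: indep_vars_def)
  have iv: "indep_var (PiM ?A ?N) ?W (PiM {p} ?N) ?Y"
    using I by (intro indep_var_restrict[OF ind]) auto
  have "expectation (\<lambda>\<omega>. ?g (?W \<omega>, ?Y \<omega>)) = 0"
  proof (rule expectation_indep_eq_0[OF iv])
    show g: "?g \<in> borel_measurable (PiM ?A ?N \<Otimes>\<^sub>M PiM {p} ?N)"
      by measurable
    show "AE \<omega> in M. (\<integral>y. ?g (?W \<omega>, y) \<partial>distr M (PiM {p} ?N) ?Y) = 0"
      using zero AE_space
    proof eventually_elim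
      case (elim \<omega>)
      have W: "?W \<omega> \<in> space (PiM ?A ?N)"
        using indep_var_rv1[OF iv] elim(2) by (rule measurable_space)
      have qN: "X q \<omega> \<in> space N" using X(2) elim(2) by (rule measurable_space)
      have "(\<integral>y. ?g (?W \<omega>, y) \<partial>distr M (PiM {p} ?N) ?Y) = (\<integral>\<omega>'. ?g (?W \<omega>, ?Y \<omega>') \<partial>M)"
        using indep_var_rv2[OF iv] measurable_compose[OF measurable_Pair1'[OF W] g]
        by (intro integral_distr)
      \<comment> \<open>With the block frozen, \<psi> is a constant and leaves the integral.\<close>
      also have "\<dots> = (\<integral>\<omega>'. f (X q \<omega>, X p \<omega>') \<partial>M) * \<psi> (X i \<omega>, X j \<omega>)"
        by simp
      also have "(\<integral>\<omega>'. f (X q \<omega>, X p \<omega>') \<partial>M) = (\<integral>y. f (X q \<omega>, y) \<partial>distr M N (X p))"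
        using measurable_compose[OF measurable_Pair1'[OF qN] f]
        by (intro integral_distr[symmetric] X)
      finally show ?case by (simp only: elim(1) mult_zero_left)
    qed
  qed
  then show ?thesis by simp
qed

lemma (in prob_space) indep_vars_pair:
  assumes ind: "indep_vars (\<lambda>_. N) X I" and ij: "i \<in> I" "j \<in> I" "i \<noteq> j"
  shows "indep_var N (X i) N (X j)"
proof -
  have "indep_var (PiM {i} (\<lambda>_. N)) (\<lambda>\<omega>. restrict (\<lambda>i. X i \<omega>) {i}) (PiM {j} (\<lambda>_. N)) (\<lambda>\<omega>. restrict (\<lambda>i. X i \<omega>) {j})"
    using ij by (intro indep_var_restrict[OF ind]) auto
  then have "indep_var N ((\<lambda>w. w i) \<circ> (\<lambda>\<omega>. restrict (\<lambda>i. X i \<omega>) {i})) N ((\<lambda>w. w j) \<circ> (\<lambda>\<omega>. restrict (\<lambda>i. X i \<omega>) {j}))"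
    by (rule indep_var_compose) auto
  then show ?thesis by (simp add: comp_def)
qed

lemma (in prob_space) indep_vars_disjoint_pairs:
  fixes f g :: "'b \<times> 'b \<Rightarrow> real"
  assumes ind: "indep_vars (\<lambda>_. N) X I" and I: "{i, j} \<subseteq> I" "{i', j'} \<subseteq> I" "{i, j} \<inter> {i', j'} = {}"
    and [measurable]: "f \<in> borel_measurable (N \<Otimes>\<^sub>M N)" "g \<in> borel_measurable (N \<Otimes>\<^sub>M N)"
  shows "indep_var borel (\<lambda>\<omega>. f (X i \<omega>, X j \<omega>)) borel (\<lambda>\<omega>. g (X i' \<omega>, X j' \<omega>))"
proof -
  have "indep_var (PiM {i, j} (\<lambda>_. N)) (\<lambda>\<omega>. restrict (\<lambda>i. X i \<omega>) {i, j})
      (PiM {i', j'} (\<lambda>_. N)) (\<lambda>\<omega>. restrict (\<lambda>i. X i \<omega>) {i', j'})"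
    using I by (intro indep_var_restrict[OF ind]) auto
  then have "indep_var borel ((\<lambda>w. f (w i, w j)) \<circ> (\<lambda>\<omega>. restrict (\<lambda>i. X i \<omega>) {i, j}))
      borel ((\<lambda>w. g (w i', w j')) \<circ> (\<lambda>\<omega>. restrict (\<lambda>i. X i \<omega>) {i', j'}))"
    by (rule indep_var_compose) measurable
  then show ?thesis by (simp add: comp_def)
qed

section \<open>Mixtures\<close>

text \<open>\<open>is_mixture\<close> speaks of measures of sets only; the standard induction
  carries the identity from indicators to nonnegative functions.\<close>

lemma nn_integral_mixture:
  assumes F: "borel_prob F" and G: "borel_prob G" and Q: "borel_prob Q"
    and mix: "is_mixture \<theta> G F Q" and \<theta>: "0 \<le> \<theta>" "\<theta> \<le> 1"
    and f: "f \<in> borel_measurable borel"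
  shows "(\<integral>\<^sup>+x. f x \<partial>Q) = ennreal \<theta> * (\<integral>\<^sup>+x. f x \<partial>G) + ennreal (1 - \<theta>) * (\<integral>\<^sup>+x. f x \<partial>F)"
proof -
  interpret F: prob_space F using F by (simp add: borel_prob_def)
  interpret G: prob_space G using G by (simp add: borel_prob_def)
  interpret Q: prob_space Q using Q by (simp add: borel_prob_def)
  have [measurable_cong]: "sets F = sets borel" "sets G = sets borel" "sets Q = sets borel"
    using F G Q by (auto simp: borel_prob_def)
  show ?thesis
    using f
  proof (induction rule: borel_measurable_induct)
    case (cong f g)
    have "space F = UNIV" "space G = UNIV" "space Q = UNIV"
      using F G Q by (auto simp: borel_prob_def dest: sets_eq_imp_space_eq)
    with cong show ?case by (simp add: cong(3) cong: nn_integral_cong)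
  next
    case (set A)
    have "emeasure Q A = ennreal (\<theta> * measure G A + (1 - \<theta>) * measure F A)"
      using mix set by (simp add: Q.emeasure_eq_measure is_mixture_def)
    also have "\<dots> = ennreal \<theta> * emeasure G A + ennreal (1 - \<theta>) * emeasure F A"
      using \<theta> by (simp add: F.emeasure_eq_measure G.emeasure_eq_measure ennreal_mult)
    finally show ?case using set by simp
  next
    case (mult u c)
    then show ?case by (simp add: nn_integral_cmult distrib_left mult.left_commute)
  next
    case (add u v)
    then show ?case by (simp add: nn_integral_add distrib_left ac_simps)
  next
    case (seq U)
    note [measurable] = seq(1)
    have mono: "incseq U" by fact
    have SUP: "(\<integral>\<^sup>+x. Sup (range U) x \<partial>N) = (SUP i. \<integral>\<^sup>+x. U i x \<partial>N)" if "sets N = sets borel" for N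
    proof -
      have "(\<integral>\<^sup>+x. Sup (range U) x \<partial>N) = (\<integral>\<^sup>+x. (SUP i. U i x) \<partial>N)"
        unfolding Sup_apply image_image ..
      also have "\<dots> = (SUP i. \<integral>\<^sup>+x. U i x \<partial>N)"
        using mono seq(1) that by (intro nn_integral_monotone_convergence_SUP) auto
      finally show ?thesis .
    qed
    \<comment> \<open>Monotonicity matters because a sum of suprema is in general the supremum of
      the sums only along increasing sequences.\<close>
    have inc: "incseq (\<lambda>i. \<integral>\<^sup>+x. U i x \<partial>N)" for N
      using mono by (auto simp: incseq_def le_fun_def intro!: nn_integral_mono)
    have inc': "incseq (\<lambda>i. c * \<integral>\<^sup>+x. U i x \<partial>N)" for N and c :: ennreal
      using inc by (auto simp: incseq_def intro!: mult_left_mono)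
    have *: "sets F = sets borel" "sets G = sets borel" "sets Q = sets borel"
      using F G Q by (auto simp: borel_prob_def)
    show ?case
      unfolding SUP[OF *(1)] SUP[OF *(2)] SUP[OF *(3)]
      by (simp add: seq SUP_mult_left_ennreal[symmetric] ennreal_SUP_add[OF inc' inc'])
  qed
qed

lemma
  fixes f :: "'a::topological_space \<Rightarrow> real"
  assumes F: "borel_prob F" and G: "borel_prob G" and Q: "borel_prob Q"
    and mix: "is_mixture \<theta> G F Q" and \<theta>: "0 \<le> \<theta>" "\<theta> \<le> 1"
    and f: "integrable F f" "integrable G f"
  shows integrable_mixture: "integrable Q f"
    and integral_mixture: "(\<integral>x. f x \<partial>Q) = \<theta> * (\<integral>x. f x \<partial>G) + (1 - \<theta>) * (\<integral>x. f x \<partial>F)"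
proof -
  have s: "sets F = sets borel" "sets G = sets borel" "sets Q = sets borel"
    using F G Q by (auto simp: borel_prob_def)
  have fb [measurable]: "f \<in> borel_measurable borel"
    using borel_measurable_integrable[OF f(1)] by (simp add: measurable_cong_sets[OF s(1)])
  have nn: "(\<integral>\<^sup>+x. ennreal (u x) \<partial>Q) = ennreal \<theta> * (\<integral>\<^sup>+x. ennreal (u x) \<partial>G) + ennreal (1 - \<theta>) * (\<integral>\<^sup>+x. ennreal (u x) \<partial>F)"
    if "u \<in> borel_measurable borel" for u :: "'a \<Rightarrow> real"
    using that by (intro nn_integral_mixture[OF F G Q mix \<theta>]) measurable
  have fin: "(\<integral>\<^sup>+x. ennreal (u x) \<partial>N) < \<infinity>" if "integrable N u" for N and u :: "'a \<Rightarrow> real"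
    using that by (metis integrableE less_top ennreal_neq_top infinity_ennreal_def real_integrable_def)
  \<comment> \<open>\<open>ennreal\<close> cuts negative values to 0, so this is the identity for
    the positive part of \<open>u\<close>. It is applied to \<open>f\<close> and to its negative;
    finiteness of both integrals makes \<open>enn2real\<close> additive.\<close>
  have split: "enn2real (\<integral>\<^sup>+x. ennreal (u x) \<partial>Q) =
      \<theta> * enn2real (\<integral>\<^sup>+x. ennreal (u x) \<partial>G) + (1 - \<theta>) * enn2real (\<integral>\<^sup>+x. ennreal (u x) \<partial>F)"
    if u: "integrable F u" "integrable G u" "u \<in> borel_measurable borel" for u :: "'a \<Rightarrow> real"
    unfolding nn[OF u(3)] using fin[OF u(1)] fin[OF u(2)] \<theta>
    by (subst enn2real_plus) (auto simp: enn2real_mult ennreal_mult_less_top)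
  show int: "integrable Q f"
  proof (rule integrableI_bounded)
    show "f \<in> borel_measurable Q" by (simp add: measurable_cong_sets[OF s(3)] fb)
    have "(\<integral>\<^sup>+x. ennreal (norm (f x)) \<partial>F) < \<infinity>" "(\<integral>\<^sup>+x. ennreal (norm (f x)) \<partial>G) < \<infinity>"
      using f by (auto simp: integrable_iff_bounded)
    then show "(\<integral>\<^sup>+x. ennreal (norm (f x)) \<partial>Q) < \<infinity>"
      by (subst nn) (auto simp: ennreal_mult_less_top)
  qed
  show "(\<integral>x. f x \<partial>Q) = \<theta> * (\<integral>x. f x \<partial>G) + (1 - \<theta>) * (\<integral>x. f x \<partial>F)"
    using split[OF f] split[of "\<lambda>x. - f x"] f
    by (simp add: real_lebesgue_integral_def int algebra_simps)
qed

lemma AE_mixture: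
  assumes F: "borel_prob F" and G: "borel_prob G" and Q: "borel_prob Q"
    and mix: "is_mixture \<theta> G F Q" 
    and ae: "AE x in F. P x" "AE x in G. P x"
  shows "AE x in Q. P x"
proof -
  interpret F: prob_space F using F by (simp add: borel_prob_def)
  interpret G: prob_space G using G by (simp add: borel_prob_def)
  interpret Q: prob_space Q using Q by (simp add: borel_prob_def)
  have s: "sets F = sets borel" "sets G = sets borel" "sets Q = sets borel"
    using F G Q by (auto simp: borel_prob_def)
  then have sp: "space F = UNIV" "space G = UNIV" "space Q = UNIV"
    by (auto dest: sets_eq_imp_space_eq)
  obtain A where A: "{x \<in> space F. \<not> P x} \<subseteq> A" "emeasure F A = 0" "A \<in> sets F"
    using ae(1) by (rule AE_E)
  obtain B where B: "{x \<in> space G. \<not> P x} \<subseteq> B" "emeasure G B = 0" "B \<in> sets G"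
    using ae(2) by (rule AE_E)
  \<comment> \<open>The exceptional set lies in \<open>A\<close> and in \<open>B\<close>. Their
    intersection is null under both components, hence under the mixture, although neither
    \<open>A\<close> nor \<open>B\<close> alone has to be.\<close>
  have "measure F (A \<inter> B) \<le> measure F A" "measure G (A \<inter> B) \<le> measure G B"
    using A B s by (auto intro!: F.finite_measure_mono G.finite_measure_mono)
  then have "measure F (A \<inter> B) = 0" "measure G (A \<inter> B) = 0"
    using A(2) B(2) by (auto simp: measure_def intro!: antisym)
  then have "measure Q (A \<inter> B) = 0"
    using mix A B s by (auto simp: is_mixture_def)
  then have "emeasure Q (A \<inter> B) = 0" by (simp add: Q.emeasure_eq_measure)
  then show ?thesis
    using A B s sp by (intro AE_I[of _ _ "A \<inter> B"]) auto
qed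

section \<open>Laws of independent pairs, and a criterion for convergence to 0\<close>

lemma (in prob_space)
  fixes f :: "'b \<times> 'b \<Rightarrow> real"
  assumes ind: "indep_var N Y N Z" and f: "f \<in> borel_measurable (N \<Otimes>\<^sub>M N)"
  shows integrable_indep_pair_iff:
      "integrable M (\<lambda>\<omega>. f (Y \<omega>, Z \<omega>)) \<longleftrightarrow> integrable (distr M N Y \<Otimes>\<^sub>M distr M N Z) f"
    and expectation_indep_pair:
      "expectation (\<lambda>\<omega>. f (Y \<omega>, Z \<omega>)) = (\<integral>z. f z \<partial>(distr M N Y \<Otimes>\<^sub>M distr M N Z))"
proof -
  from ind have [measurable]: "random_variable N Y" "random_variable N Z"
    and eq: "distr M N Y \<Otimes>\<^sub>M distr M N Z = distr M (N \<Otimes>\<^sub>M N) (\<lambda>\<omega>. (Y \<omega>, Z \<omega>))"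
    unfolding indep_var_distribution_eq by auto
  show "integrable M (\<lambda>\<omega>. f (Y \<omega>, Z \<omega>)) \<longleftrightarrow> integrable (distr M N Y \<Otimes>\<^sub>M distr M N Z) f"
    unfolding eq using f by (simp add: integrable_distr_eq)
  show "expectation (\<lambda>\<omega>. f (Y \<omega>, Z \<omega>)) = (\<integral>z. f z \<partial>(distr M N Y \<Otimes>\<^sub>M distr M N Z))"
    unfolding eq using f by (simp add: integral_distr)
qed

text \<open>Fitted to truncation arguments: the level, and with it the majorant \<open>u\<close>,
  may change with \<epsilon>, and each majorant only has to tend to its own \<epsilon>.\<close>

lemma tendsto_0_by_approx:
  fixes e :: "nat \<Rightarrow> real"
  assumes "\<And>n. 0 \<le> e n"
    and "\<And>\<epsilon>. 0 < \<epsilon> \<Longrightarrow> \<exists>u. u \<longlonglongrightarrow> \<epsilon> \<and> (\<forall>\<^sub>F n in sequentially. e n \<le> u n)"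
  shows "e \<longlonglongrightarrow> 0"
proof (rule order_tendstoI)
  fix a :: real assume "0 < a"
  then obtain u where u: "u \<longlonglongrightarrow> a / 2" "\<forall>\<^sub>F n in sequentially. e n \<le> u n"
    using assms(2)[of "a / 2"] by auto
  have "\<forall>\<^sub>F n in sequentially. u n < a"
    using \<open>0 < a\<close> by (intro order_tendstoD(2)[OF u(1)]) auto
  with u(2) show "\<forall>\<^sub>F n in sequentially. e n < a"
    by eventually_elim simp
next
  fix a :: real assume "a < 0"
  then show "\<forall>\<^sub>F n in sequentially. a < e n"
    using assms(1) by (intro always_eventually) (auto intro: less_le_trans)
qed

section \<open>Canonical U-statistics and centered sums\<close>

text \<open>With the lower end excluded, both index sets in \<open>ustat_core\<close> have this
  form: \<open>ordered_pairs 0 m\<close> for the historical sample,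
  \<open>ordered_pairs (m + r) (m + k)\<close> for the monitored one.\<close>

definition ordered_pairs :: "nat \<Rightarrow> nat \<Rightarrow> (nat \<times> nat) set" where
  "ordered_pairs l u = {(i, j). l < i \<and> i < j \<and> j \<le> u}"

lemma finite_ordered_pairs [simp]: "finite (ordered_pairs l u)"
  by (rule finite_subset[of _ "{..u} \<times> {..u}"]) (auto simp: ordered_pairs_def)

lemma sum_ordered_pairs_Suc:
  "(\<Sum>t\<in>ordered_pairs l (Suc (l + n)). f t) =
    (\<Sum>t\<in>ordered_pairs l (l + n). f t) + (\<Sum>i\<in>{l+1..l+n}. f (i, Suc (l + n)))"
proof -
  let ?J = "(\<lambda>i. (i, Suc (l + n))) ` {l+1..l+n}"
  have "ordered_pairs l (Suc (l + n)) = ordered_pairs l (l + n) \<union> ?J"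
    by (auto simp: ordered_pairs_def)
  moreover have "ordered_pairs l (l + n) \<inter> ?J = {}"
    by (auto simp: ordered_pairs_def)
  ultimately show ?thesis
    by (simp add: sum.union_disjoint sum.reindex inj_on_def)
qed

lemma ordered_pairs_self [simp]: "ordered_pairs l l = {}"
  by (auto simp: ordered_pairs_def)

lemma card_ordered_pairs: "card (ordered_pairs l (l + n)) = n choose 2"
proof (induction n)
  case (Suc n)
  then show ?case
    using sum_ordered_pairs_Suc[of "\<lambda>_. 1::nat" l n] by (simp add: numeral_2_eq_2)
qed simp

text \<open>Every index occurs in n - 1 of the pairs. This yields the linear part of the Hoeffding
  decomposition.\<close>

lemma sum_ordered_pairs_additive:
  fixes u :: "nat \<Rightarrow> real"
  shows "(\<Sum>t\<in>ordered_pairs 0 n. u (fst t) + u (snd t)) = (real n - 1) * (\<Sum>i\<in>{1..n}. u i)"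
proof (induction n)
  case (Suc n)
  then show ?case
    using sum_ordered_pairs_Suc[of "\<lambda>t. u (fst t) + u (snd t)" 0 n]
    by (simp add: sum.distrib algebra_simps)
qed simp

lemma real_choose_2: "real (n choose 2) = real n * (real n - 1) / 2"
  by (cases n) (simp_all add: choose_two algebra_simps real_of_nat_div)

text \<open>Of two distinct increasing pairs, each has an index missing from the other. Integrating
  out the variable with that index gives 0 by degeneracy, so only the diagonal of the expanded
  square survives.\<close>

lemma (in prob_space) second_moment_canonical_sum:
  fixes g :: "'b \<Rightarrow> 'b \<Rightarrow> real"
  assumes ind: "indep_vars (\<lambda>_. N) X {1..}"
    and law: "\<And>i. 1 \<le> i \<Longrightarrow> i \<le> m \<Longrightarrow> distr M N (X i) = P"
    and g [measurable]: "case_prod g \<in> borel_measurable (N \<Otimes>\<^sub>M N)"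
    and sym: "\<And>x y. g x y = g y x"
    and sq: "integrable (P \<Otimes>\<^sub>M P) (\<lambda>(x, y). (g x y)\<^sup>2)"
    and canonical: "AE x in P. (\<integral>y. g x y \<partial>P) = 0"
  shows "integrable M (\<lambda>\<omega>. (\<Sum>t\<in>ordered_pairs 0 m. g (X (fst t) \<omega>) (X (snd t) \<omega>))\<^sup>2)"
    and "expectation (\<lambda>\<omega>. (\<Sum>t\<in>ordered_pairs 0 m. g (X (fst t) \<omega>) (X (snd t) \<omega>))\<^sup>2)
      \<le> real (m choose 2) * (\<integral>(x, y). (g x y)\<^sup>2 \<partial>(P \<Otimes>\<^sub>M P))"
proof -
  let ?T = "ordered_pairs 0 m"
  let ?Z = "\<lambda>t \<omega>. g (X (fst t) \<omega>) (X (snd t) \<omega>)"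
  have X [measurable]: "X i \<in> measurable M N" if "1 \<le> i" for i
    using ind that by (auto simp: indep_vars_def)
  have T: "1 \<le> fst t" "fst t < snd t" "snd t \<le> m" if "t \<in> ?T" for t
    using that by (auto simp: ordered_pairs_def)
  have pair: "indep_var N (X i) N (X j)" if "1 \<le> i" "i < j" for i j
    using that by (intro indep_vars_pair[OF ind]) auto
  have g2: "(\<lambda>(x, y). (g x y)\<^sup>2) \<in> borel_measurable (N \<Otimes>\<^sub>M N)" by measurable
  have meas: "?Z t \<in> borel_measurable M" if "t \<in> ?T" for t
  proof -
    have [measurable]: "X (fst t) \<in> measurable M N" "X (snd t) \<in> measurable M N"
      using T[OF that] by (auto intro!: X)
    show ?thesis by measurable
  qed
  have int: "integrable M (\<lambda>\<omega>. (?Z t \<omega>)\<^sup>2)"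
    "expectation (\<lambda>\<omega>. (?Z t \<omega>)\<^sup>2) = (\<integral>(x, y). (g x y)\<^sup>2 \<partial>(P \<Otimes>\<^sub>M P))" if "t \<in> ?T" for t
  proof -
    have l: "distr M N (X (fst t)) = P" "distr M N (X (snd t)) = P"
      using T[OF that] by (auto intro!: law)
    show "integrable M (\<lambda>\<omega>. (?Z t \<omega>)\<^sup>2)"
      using integrable_indep_pair_iff[OF pair[OF T(1,2)[OF that]] g2] sq by (simp add: l)
    show "expectation (\<lambda>\<omega>. (?Z t \<omega>)\<^sup>2) = (\<integral>(x, y). (g x y)\<^sup>2 \<partial>(P \<Otimes>\<^sub>M P))"
      using expectation_indep_pair[OF pair[OF T(1,2)[OF that]] g2] by (simp add: l)
  qed
  have zero: "AE \<omega> in M. (\<integral>y. case_prod g (X q \<omega>, y) \<partial>distr M N (X p)) = 0"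
    if "1 \<le> p" "p \<le> m" "1 \<le> q" "q \<le> m" for p q
  proof -
    have "AE x in distr M N (X q). (\<integral>y. g x y \<partial>P) = 0"
      using canonical by (simp only: law[OF that(3,4)])
    then have "AE \<omega> in M. (\<integral>y. g (X q \<omega>) y \<partial>P) = 0"
      by (rule AE_distrD[OF X[OF that(3)]])
    then show ?thesis using law[OF that(1,2)] by simp
  qed
  have orth: "expectation (\<lambda>\<omega>. ?Z s \<omega> * ?Z t \<omega>) = 0" if s: "s \<in> ?T" and t: "t \<in> ?T" and "s \<noteq> t" for s t
  proof -
    \<comment> \<open>If both entries of \<open>s\<close> occurred in \<open>t\<close>, then
      \<open>s = t\<close>, since both pairs are increasing.\<close>
    consider "snd s \<notin> {fst t, snd t}" | "fst s \<notin> {fst t, snd t}"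
      using T[OF s] T[OF t] \<open>s \<noteq> t\<close> by (metis insertE less_irrefl less_trans prod.expand singletonD)
    then show ?thesis
    proof cases
      case 1
      have "expectation (\<lambda>\<omega>. case_prod g (X (fst s) \<omega>, X (snd s) \<omega>) * case_prod g (X (fst t) \<omega>, X (snd t) \<omega>)) = 0"
        using 1 T[OF s] T[OF t] by (intro expectation_orthogonal[OF ind _ _ _ _ g g zero]) auto
      then show ?thesis by simp
    next
      case 2
      \<comment> \<open>\<open>expectation_orthogonal\<close> integrates out the second argument;
        the symmetry of \<open>g\<close> moves the free index there.\<close>
      have "expectation (\<lambda>\<omega>. case_prod g (X (snd s) \<omega>, X (fst s) \<omega>) * case_prod g (X (fst t) \<omega>, X (snd t) \<omega>)) = 0"
        using 2 T[OF s] T[OF t] by (intro expectation_orthogonal[OF ind _ _ _ _ g g zero]) auto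
      then show ?thesis by (simp add: sym[of "X (snd s) _"])
    qed
  qed
  have sparse: "card {t \<in> ?T. expectation (\<lambda>\<omega>. ?Z s \<omega> * ?Z t \<omega>) \<noteq> 0} \<le> 1" if "s \<in> ?T" for s
  proof -
    have "card {t \<in> ?T. expectation (\<lambda>\<omega>. ?Z s \<omega> * ?Z t \<omega>) \<noteq> 0} \<le> card {s}"
      using orth[OF that] by (intro card_mono) auto
    then show ?thesis by simp
  qed
  note * = second_moment_sum_sparse[where Z="?Z" and T="?T" and M=M and N=1,
      OF finite_ordered_pairs meas int(1) order_eq_refl[OF int(2)] sparse]
  show "integrable M (\<lambda>\<omega>. (\<Sum>t\<in>?T. ?Z t \<omega>)\<^sup>2)" using *(1) .
  show "expectation (\<lambda>\<omega>. (\<Sum>t\<in>?T. ?Z t \<omega>)\<^sup>2) \<le> real (m choose 2) * (\<integral>(x, y). (g x y)\<^sup>2 \<partial>(P \<Otimes>\<^sub>M P))"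
    using *(2) card_ordered_pairs[of 0 m] by simp
qed

lemma (in prob_space) second_moment_centered_sum:
  fixes v :: "'b \<Rightarrow> real"
  assumes ind: "indep_vars (\<lambda>_. N) X {1..}"
    and law: "\<And>i. 1 \<le> i \<Longrightarrow> i \<le> m \<Longrightarrow> distr M N (X i) = P" and P: "prob_space P"
    and v [measurable]: "v \<in> borel_measurable N" and sq: "integrable P (\<lambda>x. (v x)\<^sup>2)"
  shows "integrable M (\<lambda>\<omega>. (\<Sum>i\<in>{1..m}. v (X i \<omega>) - (\<integral>x. v x \<partial>P))\<^sup>2)"
    and "expectation (\<lambda>\<omega>. (\<Sum>i\<in>{1..m}. v (X i \<omega>) - (\<integral>x. v x \<partial>P))\<^sup>2)
      \<le> real m * (\<integral>x. (v x - (\<integral>x. v x \<partial>P))\<^sup>2 \<partial>P)"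
proof -
  interpret P: prob_space P by fact
  let ?e = "\<integral>x. v x \<partial>P"
  let ?w = "\<lambda>x. v x - ?e"
  have X [measurable]: "X i \<in> measurable M N" if "1 \<le> i" for i
    using ind that by (auto simp: indep_vars_def)
  have *: "integrable M (\<lambda>\<omega>. (\<Sum>i\<in>{1..m}. ?w (X i \<omega>))\<^sup>2) \<and>
    expectation (\<lambda>\<omega>. (\<Sum>i\<in>{1..m}. ?w (X i \<omega>))\<^sup>2) \<le> real (card {1..m}) * real 1 * (\<integral>x. (?w x)\<^sup>2 \<partial>P)"
    if "1 \<le> m"
  proof -
    have sP: "sets P = sets N" using law[of 1] that by auto
    have vP: "v \<in> borel_measurable P" by (simp add: measurable_cong_sets[OF sP])
    have iv: "integrable P v" using P.square_integrable_imp_integrable[OF vP sq] .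
    have iw2: "integrable P (\<lambda>x. (?w x)\<^sup>2)" using iv sq by (simp add: power2_diff)
    have meas: "(\<lambda>\<omega>. ?w (X i \<omega>)) \<in> borel_measurable M" if "i \<in> {1..m}" for i
      using X[of i] that by auto
    have int: "integrable M (\<lambda>\<omega>. (?w (X i \<omega>))\<^sup>2)"
      "expectation (\<lambda>\<omega>. (?w (X i \<omega>))\<^sup>2) = (\<integral>x. (?w x)\<^sup>2 \<partial>P)" if "i \<in> {1..m}" for i
    proof -
      have i: "1 \<le> i" "i \<le> m" using that by auto
      have "integrable (distr M N (X i)) (\<lambda>x. (?w x)\<^sup>2)" using iw2 by (simp add: law[OF i])
      then show "integrable M (\<lambda>\<omega>. (?w (X i \<omega>))\<^sup>2)"
        using X[OF i(1)] by (subst (asm) integrable_distr_eq) auto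
      have "(\<integral>x. (?w x)\<^sup>2 \<partial>distr M N (X i)) = expectation (\<lambda>\<omega>. (?w (X i \<omega>))\<^sup>2)"
        using X[OF i(1)] by (intro integral_distr) auto
      then show "expectation (\<lambda>\<omega>. (?w (X i \<omega>))\<^sup>2) = (\<integral>x. (?w x)\<^sup>2 \<partial>P)"
        by (simp add: law[OF i])
    qed
    have orth: "expectation (\<lambda>\<omega>. ?w (X i \<omega>) * ?w (X j \<omega>)) = 0"
      if ij: "i \<in> {1..m}" "j \<in> {1..m}" "i \<noteq> j" for i j
    proof -
      have "(\<integral>y. ?w y \<partial>P) = 0" using iv by (simp add: P.prob_space)
      \<comment> \<open>The general orthogonality with all three frozen indices equal to
        \<open>j\<close>, each function reading one coordinate only.\<close>
      then have "expectation (\<lambda>\<omega>. (\<lambda>z. ?w (snd z)) (X j \<omega>, X i \<omega>) * (\<lambda>z. ?w (fst z)) (X j \<omega>, X j \<omega>)) = 0"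
        using ij by (intro expectation_orthogonal[OF ind]) (auto simp: law)
      then show ?thesis by simp
    qed
    have sparse: "card {j \<in> {1..m}. expectation (\<lambda>\<omega>. ?w (X i \<omega>) * ?w (X j \<omega>)) \<noteq> 0} \<le> 1"
      if "i \<in> {1..m}" for i
    proof -
      have "card {j \<in> {1..m}. expectation (\<lambda>\<omega>. ?w (X i \<omega>) * ?w (X j \<omega>)) \<noteq> 0} \<le> card {i}"
        using orth[OF that] by (intro card_mono) auto
      then show ?thesis by simp
    qed
    note * = second_moment_sum_sparse[where Z="\<lambda>i \<omega>. ?w (X i \<omega>)" and T="{1..m}" and M=M and N=1,
        OF finite_atLeastAtMost meas int(1) order_eq_refl[OF int(2)] sparse]
    show ?thesis using * by blast
  qed
  \<comment> \<open>For m = 0 the sums are empty; the argument above takes measurability with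
    respect to \<open>P\<close> from the law of \<open>X 1\<close>.\<close>
  have "m = 0 \<or> 1 \<le> m" by auto
  then show "integrable M (\<lambda>\<omega>. (\<Sum>i\<in>{1..m}. v (X i \<omega>) - ?e)\<^sup>2)"
    and "expectation (\<lambda>\<omega>. (\<Sum>i\<in>{1..m}. v (X i \<omega>) - ?e)\<^sup>2) \<le> real m * (\<integral>x. (v x - ?e)\<^sup>2 \<partial>P)"
    using * by auto
qed

section \<open>Laws of large numbers after the change\<close>

text \<open>The situation at one fixed training size, with \<open>s\<close> in the role of the
  change position, \<open>P\<close> of F and \<open>Q\<close> of the mixture. In a pair i < j the
  later observation cannot have law \<open>P\<close> when the earlier one has law \<open>Q\<close>,
  so three product laws cover all pairs.\<close>

locale change_point = prob_space M for M :: "'w measure" +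
  fixes X :: "nat \<Rightarrow> 'w \<Rightarrow> 'a::topological_space" and m s :: nat
    and P Q :: "'a measure" and h :: "'a \<Rightarrow> 'a \<Rightarrow> real"
  assumes indep: "indep_vars (\<lambda>_. borel) X {1..}"
    and m_pos: "1 \<le> m"
    and pre: "\<And>i. 1 \<le> i \<Longrightarrow> i \<le> m + s \<Longrightarrow> distr M borel (X i) = P"
    and post: "\<And>i. m + s < i \<Longrightarrow> distr M borel (X i) = Q"
    and h_measurable [measurable]: "case_prod h \<in> borel_measurable (borel \<Otimes>\<^sub>M borel)"
    and h_PP: "integrable (P \<Otimes>\<^sub>M P) (case_prod h)"
    and h_PQ: "integrable (P \<Otimes>\<^sub>M Q) (case_prod h)"
    and h_QQ: "integrable (Q \<Otimes>\<^sub>M Q) (case_prod h)"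
begin

lemma X_measurable: "1 \<le> i \<Longrightarrow> X i \<in> borel_measurable M"
  using indep by (auto simp: indep_vars_def)

lemma prob_space_P: "prob_space P" and sets_P [measurable_cong]: "sets P = sets borel"
  using pre[of 1] m_pos X_measurable[of 1] prob_space_distr[of "X 1" borel] by auto

lemma prob_space_Q: "prob_space Q" and sets_Q [measurable_cong]: "sets Q = sets borel"
  using post[of "m + s + 1"] X_measurable[of "m + s + 1"] prob_space_distr[of "X (m + s + 1)" borel]
  by auto

sublocale P: prob_space P by (rule prob_space_P)
sublocale Q: prob_space Q by (rule prob_space_Q)
sublocale PQ: pair_prob_space P Q ..
sublocale QQ: pair_prob_space Q Q ..

lemma pair_indep: "1 \<le> i \<Longrightarrow> i < j \<Longrightarrow> indep_var borel (X i) borel (X j)"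
  using indep by (intro indep_vars_pair[OF indep]) auto

lemma law: "1 \<le> i \<Longrightarrow> distr M borel (X i) = (if i \<le> m + s then P else Q)"
  using pre[of i] post[of i] by auto

lemma
  fixes u :: "'a \<Rightarrow> real"
  assumes u: "integrable P u" and i: "1 \<le> i" "i \<le> m + s"
  shows integrable_pre: "integrable M (\<lambda>\<omega>. u (X i \<omega>))"
    and expectation_pre: "expectation (\<lambda>\<omega>. u (X i \<omega>)) = (\<integral>x. u x \<partial>P)"
proof -
  note [measurable] = X_measurable[OF i(1)]
  have ub: "u \<in> borel_measurable borel"
    using borel_measurable_integrable[OF u] by (simp add: measurable_cong_sets[OF sets_P])
  show "integrable M (\<lambda>\<omega>. u (X i \<omega>))"
    using u ub unfolding pre[OF i, symmetric] by (subst (asm) integrable_distr_eq) auto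
  show "expectation (\<lambda>\<omega>. u (X i \<omega>)) = (\<integral>x. u x \<partial>P)"
    using ub unfolding pre[OF i, symmetric] by (subst integral_distr) auto
qed

lemma integrable_kernel: "integrable M (\<lambda>\<omega>. h (X i \<omega>) (X j \<omega>))" if "1 \<le> i" "i < j"
  using integrable_indep_pair_iff[OF pair_indep[OF that] h_measurable] that h_PP h_PQ h_QQ
  by (auto simp: law)

text \<open>The conditional expectation of the kernel when its second argument is drawn after the
  change. It is \<open>0\<close> at points where that integral does not exist.\<close>

definition h_post :: "'a \<Rightarrow> real" where
  "h_post x = (\<integral>y. h x y \<partial>Q)"

lemma h_post_measurable [measurable]: "h_post \<in> borel_measurable borel"
  unfolding h_post_def by measurable

lemma h_post_integrable: "integrable P h_post"
  unfolding h_post_def using PQ.integrable_fst'[OF h_PQ] by simp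

text \<open>Given \<open>X i\<close>, the terms with j > m + s are independent and centered, and the
  at most s other terms vanish after division by n. Truncation replaces the second moment that a
  variance bound would require.\<close>

lemma law_of_large_numbers_mixed:
  assumes i: "1 \<le> i" "i \<le> m"
  shows "(\<lambda>n. expectation (\<lambda>\<omega>. \<bar>\<Sum>j\<in>{m+1..m+n}. h (X i \<omega>) (X j \<omega>) - h_post (X i \<omega>)\<bar>) / real n)
    \<longlonglongrightarrow> 0"
proof (rule tendsto_0_by_approx)
  fix \<epsilon> :: real assume "0 < \<epsilon>"
  \<comment> \<open>Half of \<epsilon>, since the truncation error enters twice: in the kernel and
    in its conditional mean.\<close>
  then obtain k where k: "(\<integral>z. \<bar>case_prod h z - truncate k (case_prod h z)\<bar> \<partial>(P \<Otimes>\<^sub>M Q)) < \<epsilon> / 2"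
    using truncate_approx[OF h_PQ, of "\<epsilon> / 2"] by auto
  let ?hk = "\<lambda>x y. truncate k (h x y)"
  let ?ak = "\<lambda>x. \<integral>y. ?hk x y \<partial>Q"
  let ?D = "\<lambda>j \<omega>. h (X i \<omega>) (X j \<omega>) - h_post (X i \<omega>)"
  \<comment> \<open>The cut kernel is centered by its own conditional mean, not by
    \<open>h_post\<close>, so that orthogonality stays exact.\<close>
  let ?Z = "\<lambda>j \<omega>. ?hk (X i \<omega>) (X j \<omega>) - ?ak (X i \<omega>)"
  define C where "C = (2 * real k)\<^sup>2"
  \<comment> \<open>Bounds the mean of |\<open>?D j\<close>| at positions before the change, where
    both arguments of the kernel have law \<open>P\<close>.\<close>
  define K where "K = (\<integral>z. \<bar>case_prod h z\<bar> \<partial>(P \<Otimes>\<^sub>M P)) + (\<integral>x. \<bar>h_post x\<bar> \<partial>P)"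
  note Xi [measurable] = X_measurable[OF i(1)]
  have lawi: "distr M borel (X i) = P" using pre[of i] i by simp
  have ak_le: "\<bar>?ak x\<bar> \<le> real k" for x
  proof -
    have "\<bar>?ak x\<bar> \<le> (\<integral>y. real k \<partial>Q)"
      by (rule integral_abs_bound[THEN order_trans], rule integral_mono')
        (auto simp: abs_truncate_le)
    then show ?thesis by (simp add: Q.prob_space)
  qed
  have hk_int: "integrable Q (?hk x)" for x
    by (rule Q.integrable_const_bound[where B="real k"]) (auto simp: abs_truncate_le)
  note comp_i = integrable_pre[OF _ i(1) trans_le_add1[OF i(2)]]
    expectation_pre[OF _ i(1) trans_le_add1[OF i(2)]]
  have int_h: "integrable M (\<lambda>\<omega>. h (X i \<omega>) (X j \<omega>))" if "m < j" for j
    using that i by (intro integrable_kernel) auto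
  have int_D: "integrable M (?D j)" if "m < j" for j
    using int_h[OF that] comp_i(1)[OF h_post_integrable] by simp
  have D_pre: "expectation (\<lambda>\<omega>. \<bar>?D j \<omega>\<bar>) \<le> K" if j: "m < j" "j \<le> m + s" for j
  proof -
    have "expectation (\<lambda>\<omega>. \<bar>?D j \<omega>\<bar>) \<le> expectation (\<lambda>\<omega>. \<bar>h (X i \<omega>) (X j \<omega>)\<bar> + \<bar>h_post (X i \<omega>)\<bar>)"
      using int_D[OF j(1)] int_h[OF j(1)] comp_i(1)[OF h_post_integrable]
      by (intro integral_mono) auto
    also have "\<dots> = expectation (\<lambda>\<omega>. \<bar>h (X i \<omega>) (X j \<omega>)\<bar>) + (\<integral>x. \<bar>h_post x\<bar> \<partial>P)"
      using int_h[OF j(1)] comp_i(1)[OF h_post_integrable] comp_i(2)[OF integrable_abs[OF h_post_integrable]]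
      by simp
    also have "expectation (\<lambda>\<omega>. \<bar>h (X i \<omega>) (X j \<omega>)\<bar>) = (\<integral>z. \<bar>case_prod h z\<bar> \<partial>(P \<Otimes>\<^sub>M P))"
      using expectation_indep_pair[OF pair_indep[of i j], of "\<lambda>z. \<bar>case_prod h z\<bar>"] i j pre[of j] lawi
      by simp
    finally show ?thesis by (simp add: K_def)
  qed
  have DZ: "expectation (\<lambda>\<omega>. \<bar>?D j \<omega> - ?Z j \<omega>\<bar>) \<le> \<epsilon>" and meas_Z: "?Z j \<in> borel_measurable M"
    and Z_bound: "\<bar>?Z j \<omega>\<bar> \<le> 2 * real k" if j: "m + s < j" for j \<omega>
  proof -
    have [measurable]: "X j \<in> borel_measurable M" using j by (intro X_measurable) auto
    show "?Z j \<in> borel_measurable M" by measurable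
    show "\<bar>?Z j \<omega>\<bar> \<le> 2 * real k"
      using ak_le[of "X i \<omega>"] abs_truncate_le[of k "h (X i \<omega>) (X j \<omega>)"] by linarith
    let ?d = "\<lambda>x y. \<bar>h x y - ?hk x y\<bar>"
    have lawj: "distr M borel (X j) = Q" using post j by simp
    have ind: "indep_var borel (X i) borel (X j)" using i j by (intro pair_indep) auto
    have d_PQ: "integrable (P \<Otimes>\<^sub>M Q) (case_prod ?d)"
      by (rule Bochner_Integration.integrable_bound[OF integrable_abs[OF h_PQ]])
        (auto simp: truncate_def)
    have int_d: "integrable M (\<lambda>\<omega>. ?d (X i \<omega>) (X j \<omega>))"
      "expectation (\<lambda>\<omega>. ?d (X i \<omega>) (X j \<omega>)) = (\<integral>z. case_prod ?d z \<partial>(P \<Otimes>\<^sub>M Q))"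
      using integrable_indep_pair_iff[OF ind, of "case_prod ?d"]
        expectation_indep_pair[OF ind, of "case_prod ?d"] d_PQ by (simp_all add: lawi lawj)
    have int_dd: "integrable P (\<lambda>x. \<integral>y. ?d x y \<partial>Q)"
      "(\<integral>x. (\<integral>y. ?d x y \<partial>Q) \<partial>P) = (\<integral>z. case_prod ?d z \<partial>(P \<Otimes>\<^sub>M Q))"
      using PQ.integrable_fst'[OF d_PQ] PQ.integral_fst'[OF d_PQ] by simp_all
    \<comment> \<open>Only almost everywhere: where \<open>h x\<close> is not
      \<open>Q\<close>-integrable, \<open>h_post\<close> has the default value 0 and the estimate
      can fail.\<close>
    have ae: "AE \<omega> in M. \<bar>h_post (X i \<omega>) - ?ak (X i \<omega>)\<bar> \<le> (\<integral>y. ?d (X i \<omega>) y \<partial>Q)"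
    proof -
      have "AE x in P. \<bar>h_post x - ?ak x\<bar> \<le> (\<integral>y. ?d x y \<partial>Q)"
        using PQ.AE_integrable_fst'[OF h_PQ]
      proof eventually_elim
        case (elim x)
        then have "h_post x - ?ak x = (\<integral>y. h x y - ?hk x y \<partial>Q)"
          using hk_int by (simp add: h_post_def)
        then show ?case by (simp add: integral_abs_bound)
      qed
      then have "AE x in distr M borel (X i). \<bar>h_post x - ?ak x\<bar> \<le> (\<integral>y. ?d x y \<partial>Q)"
        by (simp only: lawi)
      then show ?thesis by (rule AE_distrD[OF Xi])
    qed
    have "expectation (\<lambda>\<omega>. \<bar>?D j \<omega> - ?Z j \<omega>\<bar>) \<le>
        expectation (\<lambda>\<omega>. ?d (X i \<omega>) (X j \<omega>) + (\<integral>y. ?d (X i \<omega>) y \<partial>Q))"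
    proof (rule integral_mono_AE)
      have "integrable M (?Z j)"
        using ak_le abs_truncate_le[of k] by (intro integrable_const_bound[where B="2 * real k"])
          (auto intro!: AE_I2 order_trans[OF abs_triangle_ineq4] add_mono[of _ "real k" _ "real k", simplified])
      then show "integrable M (\<lambda>\<omega>. \<bar>?D j \<omega> - ?Z j \<omega>\<bar>)"
        using int_D[of j] j by simp
      show "integrable M (\<lambda>\<omega>. ?d (X i \<omega>) (X j \<omega>) + (\<integral>y. ?d (X i \<omega>) y \<partial>Q))"
        using int_d(1) comp_i(1)[OF int_dd(1)] by simp
      show "AE \<omega> in M. \<bar>?D j \<omega> - ?Z j \<omega>\<bar> \<le> ?d (X i \<omega>) (X j \<omega>) + (\<integral>y. ?d (X i \<omega>) y \<partial>Q)"
        using ae by eventually_elim linarith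
    qed
    also have "\<dots> = 2 * (\<integral>z. case_prod ?d z \<partial>(P \<Otimes>\<^sub>M Q))"
      using int_d comp_i(2)[OF int_dd(1)] comp_i(1)[OF int_dd(1)] int_dd(2) by simp
    also have "\<dots> \<le> \<epsilon>"
      using k by (simp add: case_prod_beta)
    finally show "expectation (\<lambda>\<omega>. \<bar>?D j \<omega> - ?Z j \<omega>\<bar>) \<le> \<epsilon>" .
  qed
  have sq_Z: "integrable M (\<lambda>\<omega>. (?Z j \<omega>)\<^sup>2)" "expectation (\<lambda>\<omega>. (?Z j \<omega>)\<^sup>2) \<le> C"
    if j: "m + s < j" for j
  proof -
    have "(?Z j \<omega>)\<^sup>2 \<le> C" for \<omega>
      using Z_bound[OF j, of \<omega>] unfolding C_def by (rule abs_le_square_iff[THEN iffD1, OF order_trans]) simp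
    then show 1: "integrable M (\<lambda>\<omega>. (?Z j \<omega>)\<^sup>2)"
      using meas_Z[OF j] by (intro integrable_const_bound[where B=C]) auto
    have "expectation (\<lambda>\<omega>. (?Z j \<omega>)\<^sup>2) \<le> expectation (\<lambda>_. C)"
      using 1 \<open>\<And>\<omega>. (?Z j \<omega>)\<^sup>2 \<le> C\<close> by (intro integral_mono) auto
    then show "expectation (\<lambda>\<omega>. (?Z j \<omega>)\<^sup>2) \<le> C" by (simp add: prob_space)
  qed
  \<comment> \<open>\<open>X j\<close> is integrated out with \<open>X i\<close> and
    \<open>X j'\<close> frozen; the recentred kernel has inner mean 0 under
    \<open>Q\<close>.\<close>
  have orth: "expectation (\<lambda>\<omega>. ?Z j \<omega> * ?Z j' \<omega>) = 0" if j: "m + s < j" "m + s < j'" "j \<noteq> j'" for j j'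
  proof -
    let ?f = "\<lambda>z. ?hk (fst z) (snd z) - ?ak (fst z)"
    have "expectation (\<lambda>\<omega>. ?f (X i \<omega>, X j \<omega>) * ?f (X i \<omega>, X j' \<omega>)) = 0"
    proof (rule expectation_orthogonal[OF indep])
      show f: "?f \<in> borel_measurable (borel \<Otimes>\<^sub>M borel)" by measurable
      show "?f \<in> borel_measurable (borel \<Otimes>\<^sub>M borel)" by fact
      show "AE \<omega> in M. (\<integral>y. ?f (X i \<omega>, y) \<partial>distr M borel (X j)) = 0"
        using hk_int by (simp add: post[OF j(1)] Q.prob_space)
    qed (use i j in auto)
    then show ?thesis by simp
  qed
  have bound: "expectation (\<lambda>\<omega>. \<bar>\<Sum>j\<in>{m+1..m+n}. ?D j \<omega>\<bar>)
      \<le> real s * K + real n * \<epsilon> + sqrt (real n * C)" for n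
  proof -
    let ?T = "{m+1..m+n}" and ?B = "{m+1..m+n} \<inter> {m+1..m+s}"
    have K: "0 \<le> K" by (simp add: K_def)
    have "expectation (\<lambda>\<omega>. \<bar>\<Sum>j\<in>?T. ?D j \<omega>\<bar>)
        \<le> real (card ?B) * K + real (card ?T) * \<epsilon> + sqrt (real (card ?T) * real 1 * C)"
    proof (rule expectation_abs_sum_le[where Z="?Z"])
      fix j assume j: "j \<in> ?T - ?B"
      have "j' = j" if j': "j' \<in> ?T - ?B" "expectation (\<lambda>\<omega>. ?Z j \<omega> * ?Z j' \<omega>) \<noteq> 0" for j'
      proof (rule ccontr)
        assume "j' \<noteq> j"
        then have "expectation (\<lambda>\<omega>. ?Z j \<omega> * ?Z j' \<omega>) = 0"
          using j j'(1) by (intro orth) auto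
        with j'(2) show False by contradiction
      qed
      then have "card {j' \<in> ?T - ?B. expectation (\<lambda>\<omega>. ?Z j \<omega> * ?Z j' \<omega>) \<noteq> 0} \<le> card {j}"
        by (intro card_mono) auto
      then show "card {j' \<in> ?T - ?B. expectation (\<lambda>\<omega>. ?Z j \<omega> * ?Z j' \<omega>) \<noteq> 0} \<le> 1" by simp
    qed (use int_D D_pre DZ meas_Z sq_Z \<open>0 < \<epsilon>\<close> in \<open>auto simp: C_def\<close>)
    also have "\<dots> \<le> real s * K + real n * \<epsilon> + sqrt (real n * C)"
    proof -
      have "card ?B \<le> card {m+1..m+s}" by (intro card_mono) auto
      then show ?thesis using K by (simp add: mult_right_mono)
    qed
    finally show ?thesis .
  qed
  let ?u = "\<lambda>n. (real s * K + real n * \<epsilon> + sqrt (real n * C)) / real n"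
  have "0 \<le> C" by (simp add: C_def)
  \<comment> \<open>\<open>C\<close> is 0 when the truncation level is 0; the square root then drops
    out of the asymptotics.\<close>
  then have "C = 0 \<or> 0 < C" by linarith
  then have "?u \<longlonglongrightarrow> \<epsilon>"
    by (elim disjE) (simp, real_asymp, real_asymp)
  then show "\<exists>u. u \<longlonglongrightarrow> \<epsilon> \<and> (\<forall>\<^sub>F n in sequentially.
      expectation (\<lambda>\<omega>. \<bar>\<Sum>j\<in>{m+1..m+n}. ?D j \<omega>\<bar>) / real n \<le> u n)"
    using bound by (intro exI[of _ ?u] conjI always_eventually allI divide_right_mono) auto
qed simp

text \<open>Here the cut kernel is centered by a constant, so orthogonality is available for
  disjoint pairs only. A pair meets at most 4n pairs, hence the sum has standard deviation at most
  of order n^(3/2), negligible against \<open>n choose 2\<close>. So is the number of pairs that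
  start before the change, at most s n.\<close>

lemma law_of_large_numbers_post:
  "(\<lambda>n. expectation (\<lambda>\<omega>. \<bar>\<Sum>t\<in>ordered_pairs m (m + n).
      h (X (fst t) \<omega>) (X (snd t) \<omega>) - (\<integral>z. case_prod h z \<partial>(Q \<Otimes>\<^sub>M Q))\<bar>) / real (n choose 2)) \<longlonglongrightarrow> 0"
proof (rule tendsto_0_by_approx)
  fix \<epsilon> :: real assume "0 < \<epsilon>"
  then obtain k where k: "(\<integral>z. \<bar>case_prod h z - truncate k (case_prod h z)\<bar> \<partial>(Q \<Otimes>\<^sub>M Q)) < \<epsilon> / 2"
    using truncate_approx[OF h_QQ, of "\<epsilon> / 2"] by auto
  let ?h = "case_prod h" and ?hk = "\<lambda>z. truncate k (case_prod h z)"
  let ?b = "\<integral>z. ?h z \<partial>(Q \<Otimes>\<^sub>M Q)" and ?bk = "\<integral>z. ?hk z \<partial>(Q \<Otimes>\<^sub>M Q)"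
  let ?D = "\<lambda>t \<omega>. h (X (fst t) \<omega>) (X (snd t) \<omega>) - ?b"
  let ?Z = "\<lambda>t \<omega>. ?hk (X (fst t) \<omega>, X (snd t) \<omega>) - ?bk"
  define C where "C = (2 * real k)\<^sup>2"
  \<comment> \<open>A pair that starts before the change has law
    \<open>P \<Otimes>\<^sub>M P\<close> or \<open>P \<Otimes>\<^sub>M Q\<close>; adding both
    integrals covers either case.\<close>
  define K where "K = (\<integral>z. \<bar>?h z\<bar> \<partial>(P \<Otimes>\<^sub>M P)) + (\<integral>z. \<bar>?h z\<bar> \<partial>(P \<Otimes>\<^sub>M Q)) + \<bar>?b\<bar>"
  have hk_int: "integrable (Q \<Otimes>\<^sub>M Q) ?hk"
    by (rule QQ.P.integrable_const_bound[where B="real k"]) (auto simp: abs_truncate_le)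
  have bk_le: "\<bar>?bk\<bar> \<le> real k"
  proof -
    have "\<bar>?bk\<bar> \<le> (\<integral>z. real k \<partial>(Q \<Otimes>\<^sub>M Q))"
      using hk_int by (intro order_trans[OF integral_abs_bound] integral_mono) (auto simp: abs_truncate_le)
    then show ?thesis by (simp add: QQ.P.prob_space)
  qed
  have pair: "indep_var borel (X i) borel (X j)" if "m < i" "i < j" for i j
    using that by (intro pair_indep) auto
  have int_h: "integrable M (\<lambda>\<omega>. h (X i \<omega>) (X j \<omega>))" if "m < i" "i < j" for i j
    using that by (intro integrable_kernel) auto
  have D_pre: "expectation (\<lambda>\<omega>. \<bar>?D (i, j) \<omega>\<bar>) \<le> K" if ij: "m < i" "i < j" "i \<le> m + s" for i j
  proof -
    have "expectation (\<lambda>\<omega>. \<bar>?D (i, j) \<omega>\<bar>) \<le> expectation (\<lambda>\<omega>. \<bar>h (X i \<omega>) (X j \<omega>)\<bar> + \<bar>?b\<bar>)"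
      using int_h[OF ij(1,2)] by (intro integral_mono) auto
    also have "\<dots> = expectation (\<lambda>\<omega>. \<bar>h (X i \<omega>) (X j \<omega>)\<bar>) + \<bar>?b\<bar>"
      using int_h[OF ij(1,2)] by (simp add: prob_space)
    also have "expectation (\<lambda>\<omega>. \<bar>h (X i \<omega>) (X j \<omega>)\<bar>) =
        (\<integral>z. \<bar>?h z\<bar> \<partial>(P \<Otimes>\<^sub>M (if j \<le> m + s then P else Q)))"
      using expectation_indep_pair[OF pair[OF ij(1,2)], of "\<lambda>z. \<bar>?h z\<bar>"] ij by (simp add: law)
    also have "\<dots> + \<bar>?b\<bar> \<le> K"
      by (auto simp: K_def)
    finally show ?thesis by simp
  qed
  have meas_Z: "?Z t \<in> borel_measurable M" and Z_bound: "\<bar>?Z t \<omega>\<bar> \<le> 2 * real k"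
    if t: "m < fst t" "m < snd t" for t \<omega>
  proof -
    have [measurable]: "X (fst t) \<in> borel_measurable M" "X (snd t) \<in> borel_measurable M"
      using t by (auto intro!: X_measurable)
    show "?Z t \<in> borel_measurable M" by measurable
    show "\<bar>?Z t \<omega>\<bar> \<le> 2 * real k"
      using bk_le abs_truncate_le[of k "?h (X (fst t) \<omega>, X (snd t) \<omega>)"] by linarith
  qed
  have int_Z: "integrable M (?Z t)" if t: "m < fst t" "m < snd t" for t
    using meas_Z[OF t] Z_bound[OF t] by (intro integrable_const_bound[where B="2 * real k"]) auto
  have DZ: "expectation (\<lambda>\<omega>. \<bar>?D (i, j) \<omega> - ?Z (i, j) \<omega>\<bar>) \<le> \<epsilon>"
    and EZ: "expectation (?Z (i, j)) = 0" if ij: "m + s < i" "i < j" for i j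
  proof -
    have l: "distr M borel (X i) = Q" "distr M borel (X j) = Q" using ij post by auto
    have ind: "indep_var borel (X i) borel (X j)" using ij by (intro pair) auto
    have hk_meas: "?hk \<in> borel_measurable (borel \<Otimes>\<^sub>M borel)" by measurable
    have hk: "integrable M (\<lambda>\<omega>. ?hk (X i \<omega>, X j \<omega>))" "expectation (\<lambda>\<omega>. ?hk (X i \<omega>, X j \<omega>)) = ?bk"
      using integrable_indep_pair_iff[OF ind hk_meas] expectation_indep_pair[OF ind hk_meas] hk_int
      unfolding l by auto
    then show "expectation (?Z (i, j)) = 0" by (simp add: prob_space)
    let ?d = "\<lambda>z. \<bar>?h z - ?hk z\<bar>"
    have d_meas: "?d \<in> borel_measurable (borel \<Otimes>\<^sub>M borel)" by measurable
    have d_QQ: "integrable (Q \<Otimes>\<^sub>M Q) ?d" using h_QQ hk_int by simp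
    have d: "integrable M (\<lambda>\<omega>. ?d (X i \<omega>, X j \<omega>))"
      "expectation (\<lambda>\<omega>. ?d (X i \<omega>, X j \<omega>)) = (\<integral>z. ?d z \<partial>(Q \<Otimes>\<^sub>M Q))"
      using integrable_indep_pair_iff[OF ind d_meas] expectation_indep_pair[OF ind d_meas] d_QQ
      unfolding l by auto
    have "?b - ?bk = (\<integral>z. ?h z - ?hk z \<partial>(Q \<Otimes>\<^sub>M Q))" using h_QQ hk_int by simp
    then have bbk: "\<bar>?b - ?bk\<bar> \<le> (\<integral>z. ?d z \<partial>(Q \<Otimes>\<^sub>M Q))" by (simp only: integral_abs_bound)
    have "expectation (\<lambda>\<omega>. \<bar>?D (i, j) \<omega> - ?Z (i, j) \<omega>\<bar>) \<le>
        expectation (\<lambda>\<omega>. ?d (X i \<omega>, X j \<omega>) + (\<integral>z. ?d z \<partial>(Q \<Otimes>\<^sub>M Q)))"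
    proof (rule integral_mono)
      show "integrable M (\<lambda>\<omega>. \<bar>?D (i, j) \<omega> - ?Z (i, j) \<omega>\<bar>)"
        using hk(1) int_h[of i j] ij
        by (intro integrable_abs Bochner_Integration.integrable_diff) auto
      show "integrable M (\<lambda>\<omega>. ?d (X i \<omega>, X j \<omega>) + (\<integral>z. ?d z \<partial>(Q \<Otimes>\<^sub>M Q)))"
        using d(1) by (intro Bochner_Integration.integrable_add) auto
      show "\<bar>?D (i, j) \<omega> - ?Z (i, j) \<omega>\<bar> \<le> ?d (X i \<omega>, X j \<omega>) + (\<integral>z. ?d z \<partial>(Q \<Otimes>\<^sub>M Q))" for \<omega>
        using bbk unfolding fst_conv snd_conv prod.case by linarith
    qed
    also have "\<dots> = 2 * (\<integral>z. ?d z \<partial>(Q \<Otimes>\<^sub>M Q))"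
      using d by (subst Bochner_Integration.integral_add) (auto simp: prob_space)
    also have "\<dots> \<le> \<epsilon>" using k by simp
    finally show "expectation (\<lambda>\<omega>. \<bar>?D (i, j) \<omega> - ?Z (i, j) \<omega>\<bar>) \<le> \<epsilon>" .
  qed
  have sq_Z: "integrable M (\<lambda>\<omega>. (?Z t \<omega>)\<^sup>2)" "expectation (\<lambda>\<omega>. (?Z t \<omega>)\<^sup>2) \<le> C"
    if t: "m < fst t" "m < snd t" for t
  proof -
    have le: "(?Z t \<omega>)\<^sup>2 \<le> C" for \<omega>
      using Z_bound[OF t, of \<omega>] unfolding C_def by (rule abs_le_square_iff[THEN iffD1, OF order_trans]) simp
    then show 1: "integrable M (\<lambda>\<omega>. (?Z t \<omega>)\<^sup>2)"
      using meas_Z[OF t] by (intro integrable_const_bound[where B=C]) auto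
    have "expectation (\<lambda>\<omega>. (?Z t \<omega>)\<^sup>2) \<le> expectation (\<lambda>_. C)"
      using 1 le by (intro integral_mono) auto
    then show "expectation (\<lambda>\<omega>. (?Z t \<omega>)\<^sup>2) \<le> C" by (simp add: prob_space)
  qed
  have orth: "expectation (\<lambda>\<omega>. ?Z (i, j) \<omega> * ?Z (i', j') \<omega>) = 0"
    if ij: "m + s < i" "i < j" "m + s < i'" "i' < j'" "{i, j} \<inter> {i', j'} = {}" for i j i' j'
  proof -
    have "indep_var borel (\<lambda>\<omega>. (\<lambda>z. ?hk z - ?bk) (X i \<omega>, X j \<omega>))
        borel (\<lambda>\<omega>. (\<lambda>z. ?hk z - ?bk) (X i' \<omega>, X j' \<omega>))"
      using ij by (intro indep_vars_disjoint_pairs[OF indep]) auto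
    then have "expectation (\<lambda>\<omega>. ?Z (i, j) \<omega> * ?Z (i', j') \<omega>) =
        expectation (?Z (i, j)) * expectation (?Z (i', j'))"
      using int_Z[of "(i, j)"] int_Z[of "(i', j')"] ij by (intro indep_var_lebesgue_integral) auto
    then show ?thesis using EZ[OF ij(1,2)] by simp
  qed
  have bound: "expectation (\<lambda>\<omega>. \<bar>\<Sum>t\<in>ordered_pairs m (m + n). ?D t \<omega>\<bar>)
      \<le> real s * real n * K + real (n choose 2) * \<epsilon> + sqrt (real (n choose 2) * (4 * real n) * C)" for n
  proof -
    let ?T = "ordered_pairs m (m + n)"
    \<comment> \<open>Testing the first index suffices: in an increasing pair, if the first index
      lies after the change, so does the second.\<close>
    let ?B = "{t \<in> ?T. fst t \<le> m + s}"
    have K: "0 \<le> K" by (simp add: K_def)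
    have "expectation (\<lambda>\<omega>. \<bar>\<Sum>t\<in>?T. ?D t \<omega>\<bar>)
        \<le> real (card ?B) * K + real (card ?T) * \<epsilon> + sqrt (real (card ?T) * real (4 * n) * C)"
    proof (rule expectation_abs_sum_le[where Z="?Z"])
      fix t assume t: "t \<in> ?T - ?B"
      \<comment> \<open>A pair correlated with \<open>t\<close> has an entry in \<open>?t\<close>.
        There are two places for it, at most two values, and n choices for the other entry, which
        gives the 4n.\<close>
      let ?R = "{m+1..m+n}" and ?t = "{fst t, snd t}"
      have c: "card ?t \<le> 2" by (simp add: card_insert_le_m1)
      have "t' \<in> ?t \<times> ?R \<union> ?R \<times> ?t"
        if t': "t' \<in> ?T - ?B" "expectation (\<lambda>\<omega>. ?Z t \<omega> * ?Z t' \<omega>) \<noteq> 0" for t'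
      proof -
        have "?t \<inter> {fst t', snd t'} \<noteq> {}"
        proof
          assume "?t \<inter> {fst t', snd t'} = {}"
          then have "expectation (\<lambda>\<omega>. ?Z (fst t, snd t) \<omega> * ?Z (fst t', snd t') \<omega>) = 0"
            using t t'(1) by (intro orth) (auto simp: ordered_pairs_def)
          with t'(2) show False by simp
        qed
        then have "fst t' \<in> ?t \<or> snd t' \<in> ?t" by auto
        moreover have "fst t' \<in> ?R" "snd t' \<in> ?R"
          using t'(1) by (auto simp: ordered_pairs_def)
        ultimately show ?thesis unfolding Un_iff mem_Times_iff by blast
      qed
      then have "card {t' \<in> ?T - ?B. expectation (\<lambda>\<omega>. ?Z t \<omega> * ?Z t' \<omega>) \<noteq> 0} \<le> card (?t \<times> ?R \<union> ?R \<times> ?t)"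
        by (intro card_mono) auto
      also have "\<dots> \<le> card (?t \<times> ?R) + card (?R \<times> ?t)" by (rule card_Un_le)
      also have "\<dots> = 2 * (card ?t * n)" by (simp add: card_cartesian_product)
      also have "\<dots> \<le> 2 * (2 * n)" using c by (intro mult_le_mono) auto
      finally show "card {t' \<in> ?T - ?B. expectation (\<lambda>\<omega>. ?Z t \<omega> * ?Z t' \<omega>) \<noteq> 0} \<le> 4 * n" by simp
    next
      show "expectation (\<lambda>\<omega>. \<bar>?D t \<omega>\<bar>) \<le> K" if "t \<in> ?B" for t
        using D_pre[of "fst t" "snd t"] that by (auto simp: ordered_pairs_def)
      show "integrable M (?D t)" if "t \<in> ?T" for t
        using int_h[of "fst t" "snd t"] that by (auto simp: ordered_pairs_def)
      show "expectation (\<lambda>\<omega>. \<bar>?D t \<omega> - ?Z t \<omega>\<bar>) \<le> \<epsilon>" if "t \<in> ?T - ?B" for t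
        using DZ[of "fst t" "snd t"] that by (auto simp: ordered_pairs_def)
      fix t assume "t \<in> ?T - ?B"
      then have t: "m < fst t" "m < snd t" by (auto simp: ordered_pairs_def)
      show "?Z t \<in> borel_measurable M" using meas_Z[OF t] .
      show "integrable M (\<lambda>\<omega>. (?Z t \<omega>)\<^sup>2)" "expectation (\<lambda>\<omega>. (?Z t \<omega>)\<^sup>2) \<le> C"
        using sq_Z[OF t] .
    qed (use \<open>0 < \<epsilon>\<close> in \<open>auto simp: C_def\<close>)
    also have "\<dots> \<le> real s * real n * K + real (n choose 2) * \<epsilon> + sqrt (real (n choose 2) * (4 * real n) * C)"
    proof -
      have "card ?B \<le> card ({m+1..m+s} \<times> {m+1..m+n})"
        by (intro card_mono) (auto simp: ordered_pairs_def)
      then have "real (card ?B) \<le> real (s * n)"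
        by (simp only: card_cartesian_product card_atLeastAtMost of_nat_le_iff) simp
      then show ?thesis using K by (simp add: mult_right_mono card_ordered_pairs)
    qed
    finally show ?thesis .
  qed
  let ?u = "\<lambda>n. (real s * real n * K + real (n choose 2) * \<epsilon> + sqrt (real (n choose 2) * (4 * real n) * C))
      / real (n choose 2)"
  have "0 \<le> C" by (simp add: C_def)
  then have "C = 0 \<or> 0 < C" by linarith
  then have "?u \<longlonglongrightarrow> \<epsilon>"
    unfolding real_choose_2 by (elim disjE) (simp, real_asymp, real_asymp)
  then show "\<exists>u. u \<longlonglongrightarrow> \<epsilon> \<and> (\<forall>\<^sub>F n in sequentially.
      expectation (\<lambda>\<omega>. \<bar>\<Sum>t\<in>ordered_pairs m (m + n). ?D t \<omega>\<bar>) / real (n choose 2) \<le> u n)"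
    using bound by (intro exI[of _ ?u] conjI always_eventually allI divide_right_mono) auto
qed simp

end

section \<open>The detectors for large monitoring times\<close>

lemma ustat_core_alt:
  "ustat_core h x m r k =
     2 / (real (k - r) * real m) * (\<Sum>i\<in>{1..m}. \<Sum>j\<in>{m+r+1..m+k}. h (x i) (x j))
     - (\<Sum>t\<in>ordered_pairs 0 m. h (x (fst t)) (x (snd t))) / real (m choose 2)
     - (\<Sum>t\<in>ordered_pairs (m + r) (m + k). h (x (fst t)) (x (snd t))) / real ((k - r) choose 2)"
  by (simp add: ustat_core_def ordered_pairs_def case_prod_beta Suc_le_eq)

text \<open>The power has base at most 1, hence is at most 1, and 1 + q \<le> 2q for q = k/m \<ge>
  1. This is the origin of the 4 in the thresholds below.\<close>

lemma boundary_le: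
  assumes "0 \<le> \<beta>" and "1 \<le> m" "m \<le> k"
  shows "boundary \<beta> m k \<le> 4 * (real k)\<^sup>2 / (real m)\<^sup>2"
proof -
  let ?q = "real k / real m"
  have q: "1 \<le> ?q" using assms by simp
  have "(?q / (1 + ?q)) powr \<beta> \<le> 1 powr \<beta>"
    using q assms(1) by (intro powr_mono2 divide_le_eq_1_pos[THEN iffD2]) auto
  then have "boundary \<beta> m k \<le> 1 * (1 + ?q)\<^sup>2"
    unfolding boundary_def by (intro mult_right_mono) auto
  also have "\<dots> \<le> (2 * ?q)\<^sup>2"
    using q by (simp add: power_mono)
  finally show ?thesis by (simp add: power_mult_distrib power_divide)
qed

lemma detector1_le_detector2: "2 \<le> k \<Longrightarrow> detector1 h x m k \<le> detector2 h x m k"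
  unfolding detector1_def detector2_def mult.assoc
  by (intro mult_left_mono Max_ge) (auto intro!: image_eqI[of _ _ 0])

text \<open>Both sides are compared on the scale k^2/m^2, on which the detector is m|U| and the
  boundary at most 4.\<close>

lemma detector1_exceeds:
  assumes "0 \<le> \<beta>" "0 < c" "1 \<le> m" "m \<le> k" and U: "4 * c < real m * \<bar>ustat h x m 0 k\<bar>"
  shows "c * boundary \<beta> m k < detector1 h x m k"
proof -
  have k: "0 < (real k)\<^sup>2 / (real m)\<^sup>2" using assms by simp
  have "c * boundary \<beta> m k \<le> c * (4 * (real k)\<^sup>2 / (real m)\<^sup>2)"
    using assms by (intro mult_left_mono boundary_le) auto
  also have "\<dots> = 4 * c * ((real k)\<^sup>2 / (real m)\<^sup>2)" by simp
  also have "\<dots> < real m * \<bar>ustat h x m 0 k\<bar> * ((real k)\<^sup>2 / (real m)\<^sup>2)"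
    using U k by (rule mult_strict_right_mono)
  also have "\<dots> = detector1 h x m k"
    using assms(3) by (simp add: detector1_def power2_eq_square)
  finally show ?thesis .
qed

lemma stop_time_finite_iff: "stop_time c \<beta> m D < \<infinity> \<longleftrightarrow> (\<exists>k\<ge>2. c * boundary \<beta> m k < D k)"
  by (auto simp: stop_time_def)

context change_point
begin

text \<open>\<open>ustat_core\<close> at r = 0 with every average over monitored observations
  replaced by its mean under the law after the change. The historical double sum is kept, so it
  cancels in the difference from \<open>ustat\<close>.\<close>

definition ustat_limit :: "'w \<Rightarrow> real" where
  "ustat_limit \<omega> = 2 / real m * (\<Sum>i\<in>{1..m}. h_post (X i \<omega>))
     - (\<Sum>t\<in>ordered_pairs 0 m. h (X (fst t) \<omega>) (X (snd t) \<omega>)) / real (m choose 2)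
     - (\<integral>z. case_prod h z \<partial>(Q \<Otimes>\<^sub>M Q))"

lemma h_X_measurable: "1 \<le> i \<Longrightarrow> 1 \<le> j \<Longrightarrow> (\<lambda>\<omega>. h (X i \<omega>) (X j \<omega>)) \<in> borel_measurable M"
  using measurable_compose[OF measurable_Pair h_measurable, of "X i" M "X j"] X_measurable by simp

lemma ustat_limit_measurable [measurable]: "ustat_limit \<in> borel_measurable M"
  unfolding ustat_limit_def
  by (intro borel_measurable_diff borel_measurable_times borel_measurable_divide borel_measurable_sum
      measurable_compose[OF X_measurable h_post_measurable] h_X_measurable borel_measurable_const)
    (auto simp: ordered_pairs_def)

lemma ustat_measurable [measurable]: "(\<lambda>\<omega>. ustat h (\<lambda>i. X i \<omega>) m r k) \<in> borel_measurable M"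
proof -
  have "(\<lambda>\<omega>. ustat_core h (\<lambda>i. X i \<omega>) m r k) \<in> borel_measurable M" for r
    unfolding ustat_core_alt
    by (intro borel_measurable_diff borel_measurable_times borel_measurable_divide borel_measurable_sum
        h_X_measurable borel_measurable_const) (auto simp: ordered_pairs_def)
  then show ?thesis unfolding ustat_def by simp
qed

lemma detector_measurable:
  assumes "2 \<le> k" "detector \<in> {detector1, detector2}"
  shows "(\<lambda>\<omega>. detector h (\<lambda>i. X i \<omega>) m k) \<in> borel_measurable M"
  using assms(2)
proof (elim insertE emptyE)
  assume d: "detector = detector1"
  show ?thesis unfolding d detector1_def by measurable
next
  assume d: "detector = detector2"
  show ?thesis unfolding d detector2_def
    using assms(1) by (intro borel_measurable_times borel_measurable_const borel_measurable_Max) auto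
qed

text \<open>Markov's inequality for an L^1 majorant \<open>?g\<close> assembled from the two laws of
  large numbers.\<close>

lemma ustat_tail:
  assumes "0 < \<delta>"
  shows "(\<lambda>n. prob {\<omega> \<in> space M. \<delta> \<le> \<bar>ustat h (\<lambda>i. X i \<omega>) m 0 n - ustat_limit \<omega>\<bar>}) \<longlonglongrightarrow> 0"
proof -
  let ?b = "\<integral>z. case_prod h z \<partial>(Q \<Otimes>\<^sub>M Q)"
  let ?A = "\<lambda>n i \<omega>. \<bar>\<Sum>j\<in>{m+1..m+n}. h (X i \<omega>) (X j \<omega>) - h_post (X i \<omega>)\<bar>"
  let ?B = "\<lambda>n \<omega>. \<bar>\<Sum>t\<in>ordered_pairs m (m + n). h (X (fst t) \<omega>) (X (snd t) \<omega>) - ?b\<bar>"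
  let ?g = "\<lambda>n \<omega>. 2 / real m * (\<Sum>i\<in>{1..m}. ?A n i \<omega> / real n) + ?B n \<omega> / real (n choose 2)"
  have int_A: "integrable M (?A n i)" if "i \<in> {1..m}" for n i
    using that by (intro integrable_abs Bochner_Integration.integrable_sum
        Bochner_Integration.integrable_diff integrable_kernel integrable_pre[OF h_post_integrable]) auto
  have int_B: "integrable M (?B n)" for n
    by (intro integrable_abs Bochner_Integration.integrable_sum
        Bochner_Integration.integrable_diff integrable_kernel integrable_const) (auto simp: ordered_pairs_def)
  have int_SA: "integrable M (\<lambda>\<omega>. 2 / real m * (\<Sum>i\<in>{1..m}. ?A n i \<omega> / real n))" for n
    using int_A by (intro integrable_mult_right Bochner_Integration.integrable_sum integrable_divide)
  have int_g: "integrable M (?g n)" for n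
    using int_SA int_B by (intro Bochner_Integration.integrable_add integrable_divide)
  have "expectation (?g n) = 2 / real m * (\<Sum>i\<in>{1..m}. expectation (?A n i) / real n)
      + expectation (?B n) / real (n choose 2)" for n
  proof -
    have "expectation (?g n) = expectation (\<lambda>\<omega>. 2 / real m * (\<Sum>i\<in>{1..m}. ?A n i \<omega> / real n))
        + expectation (\<lambda>\<omega>. ?B n \<omega> / real (n choose 2))"
      using int_SA int_B by (intro Bochner_Integration.integral_add integrable_divide)
    also have "expectation (\<lambda>\<omega>. 2 / real m * (\<Sum>i\<in>{1..m}. ?A n i \<omega> / real n)) =
        2 / real m * (\<Sum>i\<in>{1..m}. expectation (\<lambda>\<omega>. ?A n i \<omega> / real n))"
      using int_A by (subst integral_mult_right_zero, subst Bochner_Integration.integral_sum)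
        (auto intro: integrable_divide)
    finally show ?thesis by simp
  qed
  moreover have "(\<lambda>n. 2 / real m * (\<Sum>i\<in>{1..m}. expectation (?A n i) / real n)
      + expectation (?B n) / real (n choose 2)) \<longlonglongrightarrow> 2 / real m * (\<Sum>i\<in>{1..m}. 0) + 0"
    using law_of_large_numbers_mixed
    by (intro tendsto_add tendsto_mult tendsto_const tendsto_sum law_of_large_numbers_post) auto
  ultimately have "(\<lambda>n. expectation (?g n)) \<longlonglongrightarrow> 0" by simp
  then have lim: "(\<lambda>n. expectation (?g n) / \<delta>) \<longlonglongrightarrow> 0"
    using tendsto_divide_zero by blast
  \<comment> \<open>\<open>2 \<le> n\<close> keeps \<open>ustat\<close> at r = 0 out of its branch r
    = k - 1 and makes \<open>n choose 2\<close> nonzero.\<close>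
  have le_g: "\<bar>ustat h (\<lambda>i. X i \<omega>) m 0 n - ustat_limit \<omega>\<bar> \<le> ?g n \<omega>" if n: "2 \<le> n" for n \<omega>
  proof -
    let ?SB = "\<Sum>t\<in>ordered_pairs m (m + n). h (X (fst t) \<omega>) (X (snd t) \<omega>)"
    let ?SA = "\<lambda>i. \<Sum>j\<in>{m+1..m+n}. h (X i \<omega>) (X j \<omega>)"
    have nc: "real (n choose 2) \<noteq> 0" using n by simp
    have frac: "\<bar>x\<bar> / real k = \<bar>x / real k\<bar>" for x k by (simp add: abs_divide)
    have A: "?A n i \<omega> / real n = \<bar>?SA i / real n - h_post (X i \<omega>)\<bar>" for i
    proof -
      have "(\<Sum>j\<in>{m+1..m+n}. h (X i \<omega>) (X j \<omega>) - h_post (X i \<omega>)) / real n =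
          ?SA i / real n - h_post (X i \<omega>)"
        using n by (simp add: sum_subtractf diff_divide_distrib)
      then show ?thesis by (simp only: frac)
    qed
    have B: "?B n \<omega> / real (n choose 2) = \<bar>?SB / real (n choose 2) - ?b\<bar>"
    proof -
      have "(\<Sum>t\<in>ordered_pairs m (m + n). h (X (fst t) \<omega>) (X (snd t) \<omega>) - ?b) / real (n choose 2) =
          ?SB / real (n choose 2) - ?b"
        using nc by (simp add: sum_subtractf card_ordered_pairs diff_divide_distrib)
      then show ?thesis by (simp only: frac)
    qed
    let ?d = "\<lambda>i. ?SA i / real n - h_post (X i \<omega>)"
    have d: "(\<Sum>i\<in>{1..m}. ?d i) = (\<Sum>i\<in>{1..m}. ?SA i) / real n - (\<Sum>i\<in>{1..m}. h_post (X i \<omega>))"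
      by (simp only: sum_subtractf sum_divide_distrib)
    have alg: "2 / (x * y) * S - W - T - (2 / y * A - W - b) = 2 / y * (S / x - A) - (T - b)"
      for x y S W T A b :: real
      by (simp add: right_diff_distrib)
    have U: "ustat h (\<lambda>i. X i \<omega>) m 0 n - ustat_limit \<omega> =
        2 / real m * (\<Sum>i\<in>{1..m}. ?d i) - (?SB / real (n choose 2) - ?b)"
    proof -
      have "ustat h (\<lambda>i. X i \<omega>) m 0 n = 2 / (real n * real m) * (\<Sum>i\<in>{1..m}. ?SA i)
          - (\<Sum>t\<in>ordered_pairs 0 m. h (X (fst t) \<omega>) (X (snd t) \<omega>)) / real (m choose 2)
          - ?SB / real (n choose 2)"
        using n by (simp add: ustat_def ustat_core_alt)
      then show ?thesis unfolding d ustat_limit_def by (simp only: alg)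
    qed
    have "\<bar>2 / real m * (\<Sum>i\<in>{1..m}. ?d i)\<bar> = 2 / real m * \<bar>\<Sum>i\<in>{1..m}. ?d i\<bar>"
      by (subst abs_mult) simp
    also have "\<dots> \<le> 2 / real m * (\<Sum>i\<in>{1..m}. \<bar>?d i\<bar>)"
      by (intro mult_left_mono sum_abs) simp
    finally have "\<bar>ustat h (\<lambda>i. X i \<omega>) m 0 n - ustat_limit \<omega>\<bar> \<le>
        2 / real m * (\<Sum>i\<in>{1..m}. \<bar>?d i\<bar>) + \<bar>?SB / real (n choose 2) - ?b\<bar>"
      unfolding U by (intro order_trans[OF abs_triangle_ineq4] add_mono order_refl)
    also have "\<dots> = ?g n \<omega>" by (simp only: A B)
    finally show ?thesis .
  qed
  have "\<forall>\<^sub>F n in sequentially. prob {\<omega> \<in> space M. \<delta> \<le> \<bar>ustat h (\<lambda>i. X i \<omega>) m 0 n - ustat_limit \<omega>\<bar>}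
      \<le> expectation (?g n) / \<delta>"
    using eventually_ge_at_top[of 2]
  proof eventually_elim
    case (elim n)
    have [measurable]: "?g n \<in> borel_measurable M" using int_g by (rule borel_measurable_integrable)
    have "prob {\<omega> \<in> space M. \<delta> \<le> \<bar>ustat h (\<lambda>i. X i \<omega>) m 0 n - ustat_limit \<omega>\<bar>}
        \<le> prob {\<omega> \<in> space M. \<delta> \<le> ?g n \<omega>}"
    proof (rule finite_measure_mono)
      show "{\<omega> \<in> space M. \<delta> \<le> \<bar>ustat h (\<lambda>i. X i \<omega>) m 0 n - ustat_limit \<omega>\<bar>}
          \<subseteq> {\<omega> \<in> space M. \<delta> \<le> ?g n \<omega>}"
        using order_trans[OF _ le_g[OF elim]] by blast
    qed measurable
    also have "\<dots> \<le> expectation (?g n) / \<delta>"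
    proof (rule integral_Markov_inequality_measure[where A="{}", OF int_g])
      show "AE \<omega> in M. 0 \<le> ?g n \<omega>"
        by (intro AE_I2 order_trans[OF abs_ge_zero le_g[OF elim]])
    qed (use \<open>0 < \<delta>\<close> in auto)
    finally show ?case .
  qed
  then show ?thesis
    by (intro tendsto_sandwich[OF _ _ tendsto_const lim]) (auto simp: always_eventually)
qed

text \<open>The detection event does not depend on the monitoring time n at which the limit is
  compared with the statistic, so the comparison error can be sent to 0 at the end.\<close>

lemma detection_probability:
  assumes "0 \<le> \<beta>" "0 < c" and detector: "detector \<in> {detector1, detector2}"
  shows "1 - prob {\<omega> \<in> space M. real m * \<bar>ustat_limit \<omega>\<bar> \<le> 4 * c + 1}
    \<le> prob {\<omega> \<in> space M. stop_time c \<beta> m (\<lambda>k. detector h (\<lambda>i. X i \<omega>) m k) < \<infinity>}"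
    (is "1 - prob ?L \<le> prob ?S")
proof -
  \<comment> \<open>Multiplied by m, the tolerance 1/m becomes 1, the gap between 4c + 1 and
    4c.\<close>
  let ?E = "\<lambda>n. {\<omega> \<in> space M. 1 / real m \<le> \<bar>ustat h (\<lambda>i. X i \<omega>) m 0 n - ustat_limit \<omega>\<bar>}"
  have S [measurable]: "?S \<in> events"
  proof -
    have "?S = (\<Union>k\<in>{2..}. {\<omega> \<in> space M. c * boundary \<beta> m k < detector h (\<lambda>i. X i \<omega>) m k})"
      unfolding stop_time_finite_iff by auto
    also have "\<dots> \<in> events"
      using detector_measurable[OF _ detector] by (intro sets.countable_UN') auto
    finally show ?thesis .
  qed
  have "1 - prob ?L - prob (?E n) \<le> prob ?S" if n: "max 2 m \<le> n" for n
  proof -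
    have "\<omega> \<in> ?S \<union> (?L \<union> ?E n)" if \<omega>: "\<omega> \<in> space M" for \<omega>
    proof (rule ccontr)
      assume not: "\<omega> \<notin> ?S \<union> (?L \<union> ?E n)"
      let ?U = "ustat h (\<lambda>i. X i \<omega>) m 0 n"
      have "\<bar>?U - ustat_limit \<omega>\<bar> < 1 / real m" using not \<omega> by auto
      then have "real m * \<bar>?U - ustat_limit \<omega>\<bar> < 1" using m_pos by (simp add: field_simps)
      moreover have "4 * c + 1 < real m * \<bar>ustat_limit \<omega>\<bar>" using not \<omega> by auto
      moreover have "real m * \<bar>ustat_limit \<omega>\<bar> \<le> real m * (\<bar>?U\<bar> + \<bar>?U - ustat_limit \<omega>\<bar>)"
        by (intro mult_left_mono) auto
      ultimately have "4 * c < real m * \<bar>?U\<bar>" by (simp add: distrib_left)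
      then have "c * boundary \<beta> m n < detector1 h (\<lambda>i. X i \<omega>) m n"
        using assms m_pos n by (intro detector1_exceeds) auto
      also have "\<dots> \<le> detector h (\<lambda>i. X i \<omega>) m n"
        using detector detector1_le_detector2[of n h "\<lambda>i. X i \<omega>" m] n by auto
      finally have "stop_time c \<beta> m (\<lambda>k. detector h (\<lambda>i. X i \<omega>) m k) < \<infinity>"
        using n unfolding stop_time_finite_iff by auto
      then show False using not \<omega> by auto
    qed
    then have "space M \<subseteq> ?S \<union> (?L \<union> ?E n)" by blast
    then have "prob (space M) \<le> prob (?S \<union> (?L \<union> ?E n))"
      by (rule finite_measure_mono) (intro sets.Un S; measurable)
    also have "\<dots> \<le> prob ?S + prob (?L \<union> ?E n)" by (intro measure_Un_le) measurable
    also have "prob (?L \<union> ?E n) \<le> prob ?L + prob (?E n)" by (intro measure_Un_le) measurable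
    finally show ?thesis by (simp add: prob_space)
  qed
  moreover have "(\<lambda>n. 1 - prob ?L - prob (?E n)) \<longlonglongrightarrow> 1 - prob ?L - 0"
    using m_pos by (intro tendsto_diff tendsto_const ustat_tail) auto
  ultimately show ?thesis
    by (intro tendsto_upperbound[of "\<lambda>n. 1 - prob ?L - prob (?E n)"])
      (auto simp: eventually_at_top_linorder intro!: exI[of _ "max 2 m"])
qed

end

section \<open>Fluctuations of the limit\<close>

text \<open>The completely degenerate part in Hoeffding's decomposition of a symmetric kernel; for
  such a kernel the term with \<open>h y z\<close> is the projection on the second argument.\<close>

definition canonical_part :: "'a measure \<Rightarrow> ('a \<Rightarrow> 'a \<Rightarrow> real) \<Rightarrow> 'a \<Rightarrow> 'a \<Rightarrow> real" where
  "canonical_part F h x y = h x y - (\<integral>z. h x z \<partial>F) - (\<integral>z. h y z \<partial>F) + (\<integral>z. case_prod h z \<partial>(F \<Otimes>\<^sub>M F))"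

lemma
  fixes h :: "'a::topological_space \<Rightarrow> 'a \<Rightarrow> real"
  assumes F: "borel_prob F"
    and h: "case_prod h \<in> borel_measurable (borel \<Otimes>\<^sub>M borel)"
    and sq: "integrable (F \<Otimes>\<^sub>M F) (\<lambda>(x, y). (h x y)\<^sup>2)"
  shows canonical_part_measurable: "case_prod (canonical_part F h) \<in> borel_measurable (borel \<Otimes>\<^sub>M borel)"
    and integrable_canonical_part_sq: "integrable (F \<Otimes>\<^sub>M F) (\<lambda>(x, y). (canonical_part F h x y)\<^sup>2)"
    and canonical_part_canonical: "AE x in F. (\<integral>y. canonical_part F h x y \<partial>F) = 0"
    and integrable_of_integrable_sq: "integrable (F \<Otimes>\<^sub>M F) (case_prod h)"
proof -
  interpret F: prob_space F using F by (simp add: borel_prob_def)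
  interpret FF: pair_prob_space F F ..
  have sF [measurable_cong]: "sets F = sets borel" using F by (simp add: borel_prob_def)
  note h [measurable]
  let ?h1 = "\<lambda>x. \<integral>y. h x y \<partial>F" and ?\<mu> = "\<integral>z. case_prod h z \<partial>(F \<Otimes>\<^sub>M F)"
  show [measurable]: "case_prod (canonical_part F h) \<in> borel_measurable (borel \<Otimes>\<^sub>M borel)"
    unfolding canonical_part_def by measurable
  have sq': "integrable (F \<Otimes>\<^sub>M F) (\<lambda>z. (case_prod h z)\<^sup>2)"
  proof -
    have "(\<lambda>(x, y). (h x y)\<^sup>2) = (\<lambda>z. (case_prod h z)\<^sup>2)" by auto
    with sq show ?thesis by simp
  qed
  show int: "integrable (F \<Otimes>\<^sub>M F) (case_prod h)"
    by (rule FF.P.square_integrable_imp_integrable[OF _ sq']) measurable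
  have h1: "integrable F ?h1" "(\<integral>x. ?h1 x \<partial>F) = ?\<mu>"
    using FF.integrable_fst'[OF int] FF.integral_fst'[OF int] by simp_all
  have ae: "AE x in F. integrable F (h x)" using FF.AE_integrable_fst'[OF int] by simp
  have ae2: "AE x in F. integrable F (\<lambda>y. (h x y)\<^sup>2)" using FF.AE_integrable_fst'[OF sq'] by simp
  show "AE x in F. (\<integral>y. canonical_part F h x y \<partial>F) = 0"
    using ae by eventually_elim (simp add: canonical_part_def h1 F.prob_space)
  have h1_sq: "integrable F (\<lambda>x. (?h1 x)\<^sup>2)"
  proof (rule Bochner_Integration.integrable_bound)
    show "integrable F (\<lambda>x. \<integral>y. (h x y)\<^sup>2 \<partial>F)" using FF.integrable_fst'[OF sq'] by simp
    show "AE x in F. norm ((?h1 x)\<^sup>2) \<le> norm (\<integral>y. (h x y)\<^sup>2 \<partial>F)"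
      using ae ae2
    proof eventually_elim
      case (elim x)
      \<comment> \<open>Jensen's inequality on a section, as nonnegativity of a variance.\<close>
      have "0 \<le> (\<integral>y. (h x y)\<^sup>2 \<partial>F) - (?h1 x)\<^sup>2"
        using F.variance_eq[OF elim] F.variance_positive[of "h x"] by simp
      then show ?case by simp
    qed
  qed measurable
  have h1_pair: "integrable (F \<Otimes>\<^sub>M F) (\<lambda>z. (?h1 (fst z))\<^sup>2)" "integrable (F \<Otimes>\<^sub>M F) (\<lambda>z. (?h1 (snd z))\<^sup>2)"
  proof -
    have "integrable (distr (F \<Otimes>\<^sub>M F) F fst) (\<lambda>x. (?h1 x)\<^sup>2)"
      using h1_sq by (simp add: F.distr_pair_fst)
    then show 1: "integrable (F \<Otimes>\<^sub>M F) (\<lambda>z. (?h1 (fst z))\<^sup>2)"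
      by (subst (asm) integrable_distr_eq) auto
    show "integrable (F \<Otimes>\<^sub>M F) (\<lambda>z. (?h1 (snd z))\<^sup>2)"
      using FF.integrable_product_swap[OF 1] by (simp add: split_beta')
  qed
  show "integrable (F \<Otimes>\<^sub>M F) (\<lambda>(x, y). (canonical_part F h x y)\<^sup>2)"
  proof (rule Bochner_Integration.integrable_bound)
    show "integrable (F \<Otimes>\<^sub>M F)
        (\<lambda>z. 4 * ((case_prod h z)\<^sup>2 + (?h1 (fst z))\<^sup>2 + (?h1 (snd z))\<^sup>2 + ?\<mu>\<^sup>2))"
      using sq' h1_pair by (intro integrable_mult_right Bochner_Integration.integrable_add) auto
    \<comment> \<open>Cauchy-Schwarz for four terms; the defect is a sum of six squares, one for
      each pair of terms.\<close>
    have "(a - b - c + d)\<^sup>2 \<le> 4 * (a\<^sup>2 + b\<^sup>2 + c\<^sup>2 + d\<^sup>2)" for a b c d :: real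
    proof -
      have "4 * (a\<^sup>2 + b\<^sup>2 + c\<^sup>2 + d\<^sup>2) - (a - b - c + d)\<^sup>2 =
          (a + b)\<^sup>2 + (a + c)\<^sup>2 + (a - d)\<^sup>2 + (b - c)\<^sup>2 + (b + d)\<^sup>2 + (c + d)\<^sup>2"
        by (simp add: power2_eq_square algebra_simps)
      then show ?thesis by (smt (verit) zero_le_power2)
    qed
    then show "AE z in F \<Otimes>\<^sub>M F. norm (case z of (x, y) \<Rightarrow> (canonical_part F h x y)\<^sup>2)
        \<le> norm (4 * ((case_prod h z)\<^sup>2 + (?h1 (fst z))\<^sup>2 + (?h1 (snd z))\<^sup>2 + ?\<mu>\<^sup>2))"
      by (intro AE_I2) (auto simp: canonical_part_def)
  qed measurable
qed

context change_point
begin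

text \<open>The hypotheses express the limit through its Hoeffding decomposition: a degenerate part, a
  centered linear part of size \<open>\<theta>\<close>, and the deterministic drift \<open>\<theta>\<^sup>2 * D\<close>.\<close>

lemma ustat_limit_small_probability:
  fixes v :: "'a \<Rightarrow> real"
  assumes m: "2 \<le> m" and sym: "\<And>x y. h x y = h y x"
    and sq: "integrable (P \<Otimes>\<^sub>M P) (\<lambda>(x, y). (h x y)\<^sup>2)"
    and v: "v \<in> borel_measurable borel" "integrable P (\<lambda>x. (v x)\<^sup>2)"
    and h_post: "AE x in P. h_post x = (\<integral>y. h x y \<partial>P) - \<theta> * v x"
    and mean: "(\<integral>z. case_prod h z \<partial>(Q \<Otimes>\<^sub>M Q)) =
      (\<integral>z. case_prod h z \<partial>(P \<Otimes>\<^sub>M P)) - 2 * \<theta> * (\<integral>x. v x \<partial>P) + \<theta>\<^sup>2 * D"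
    and K: "K < real m * \<theta>\<^sup>2 * \<bar>D\<bar>"
  shows "prob {\<omega> \<in> space M. real m * \<bar>ustat_limit \<omega>\<bar> \<le> K} \<le>
    (8 * (\<integral>(x, y). (canonical_part P h x y)\<^sup>2 \<partial>(P \<Otimes>\<^sub>M P))
      + 8 * (real m * \<theta>\<^sup>2 * (\<integral>x. (v x - (\<integral>x. v x \<partial>P))\<^sup>2 \<partial>P))) / (real m * \<theta>\<^sup>2 * \<bar>D\<bar> - K)\<^sup>2"
proof -
  let ?\<mu> = "\<integral>z. case_prod h z \<partial>(P \<Otimes>\<^sub>M P)" and ?h1 = "\<lambda>x. \<integral>y. h x y \<partial>P" and ?e = "\<integral>x. v x \<partial>P"
  let ?g = "canonical_part P h"
  let ?S1 = "\<lambda>\<omega>. \<Sum>t\<in>ordered_pairs 0 m. ?g (X (fst t) \<omega>) (X (snd t) \<omega>)"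
  let ?S2 = "\<lambda>\<omega>. \<Sum>i\<in>{1..m}. v (X i \<omega>) - ?e"
  \<comment> \<open>The negative of the fluctuation of \<open>real m * ustat_limit \<omega>\<close>.
    The factor 2/(m - 1) is m divided by \<open>m choose 2\<close>; the factor 2\<theta> is the 2 of
    the mixed sum times the \<theta> in \<open>h_post\<close>.\<close>
  let ?R = "\<lambda>\<omega>. 2 / (real m - 1) * ?S1 \<omega> + 2 * \<theta> * ?S2 \<omega>"
  let ?q = "real m * \<theta>\<^sup>2 * \<bar>D\<bar>"
  define H where "H = (\<integral>(x, y). (?g x y)\<^sup>2 \<partial>(P \<Otimes>\<^sub>M P))"
  define V where "V = (\<integral>x. (v x - ?e)\<^sup>2 \<partial>P)"
  have bP: "borel_prob P" using prob_space_P sets_P by (simp add: borel_prob_def)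
  note g = canonical_part_measurable[OF bP h_measurable sq]
    integrable_canonical_part_sq[OF bP h_measurable sq] canonical_part_canonical[OF bP h_measurable sq]
  have g_sym: "?g x y = ?g y x" for x y by (simp add: canonical_part_def sym[of x y])
  have H0: "0 \<le> H" unfolding H_def by (rule integral_nonneg_AE) auto
  have lawP: "distr M borel (X i) = P" if "1 \<le> i" "i \<le> m" for i using pre[of i] that by simp
  have S1: "integrable M (\<lambda>\<omega>. (?S1 \<omega>)\<^sup>2)" "expectation (\<lambda>\<omega>. (?S1 \<omega>)\<^sup>2) \<le> real (m choose 2) * H"
    unfolding H_def by (rule second_moment_canonical_sum[OF indep lawP g(1) g_sym g(2,3)]; assumption)+
  have S2: "integrable M (\<lambda>\<omega>. (?S2 \<omega>)\<^sup>2)" "expectation (\<lambda>\<omega>. (?S2 \<omega>)\<^sup>2) \<le> real m * V"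
    unfolding V_def by (rule second_moment_centered_sum[OF indep lawP prob_space_P v]; assumption)+
  have meas_S1 [measurable]: "?S1 \<in> borel_measurable M"
  proof (intro borel_measurable_sum)
    fix t assume "t \<in> ordered_pairs 0 m"
    then have [measurable]: "X (fst t) \<in> borel_measurable M" "X (snd t) \<in> borel_measurable M"
      by (auto simp: ordered_pairs_def intro!: X_measurable)
    note g(1) [measurable]
    show "(\<lambda>\<omega>. ?g (X (fst t) \<omega>) (X (snd t) \<omega>)) \<in> borel_measurable M" by measurable
  qed
  have meas_S2 [measurable]: "?S2 \<in> borel_measurable M"
    by (intro borel_measurable_sum borel_measurable_diff measurable_compose[OF X_measurable v(1)]) auto
  \<comment> \<open>8 = 2 * 2^2, from (a + b)^2 \<le> 2a^2 + 2b^2 and the factors 2 in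
    \<open>?R\<close>.\<close>
  have R2_le: "(?R \<omega>)\<^sup>2 \<le> 8 / (real m - 1)\<^sup>2 * (?S1 \<omega>)\<^sup>2 + 8 * \<theta>\<^sup>2 * (?S2 \<omega>)\<^sup>2" for \<omega>
  proof -
    have "(a + b)\<^sup>2 \<le> 2 * a\<^sup>2 + 2 * b\<^sup>2" for a b :: real
      using sum_squares_bound[of a b] by (simp add: power2_sum)
    from this[of "2 / (real m - 1) * ?S1 \<omega>" "2 * \<theta> * ?S2 \<omega>"]
    show ?thesis by (simp add: power_mult_distrib power_divide)
  qed
  have int_bd: "integrable M (\<lambda>\<omega>. 8 / (real m - 1)\<^sup>2 * (?S1 \<omega>)\<^sup>2 + 8 * \<theta>\<^sup>2 * (?S2 \<omega>)\<^sup>2)"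
    using S1(1) S2(1) by (intro Bochner_Integration.integrable_add integrable_mult_right)
  have int_R2: "integrable M (\<lambda>\<omega>. (?R \<omega>)\<^sup>2)"
    by (rule Bochner_Integration.integrable_bound[OF int_bd])
      (use R2_le in \<open>measurable, auto intro!: AE_I2 intro: order_trans[OF _ abs_ge_self]\<close>)
  have "expectation (\<lambda>\<omega>. (?R \<omega>)\<^sup>2) \<le>
      expectation (\<lambda>\<omega>. 8 / (real m - 1)\<^sup>2 * (?S1 \<omega>)\<^sup>2 + 8 * \<theta>\<^sup>2 * (?S2 \<omega>)\<^sup>2)"
    by (intro integral_mono int_R2 int_bd R2_le)
  also have "\<dots> = 8 / (real m - 1)\<^sup>2 * expectation (\<lambda>\<omega>. (?S1 \<omega>)\<^sup>2) + 8 * \<theta>\<^sup>2 * expectation (\<lambda>\<omega>. (?S2 \<omega>)\<^sup>2)"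
    using S1(1) S2(1) by (subst Bochner_Integration.integral_add) (auto intro: integrable_mult_right)
  also have "\<dots> \<le> 8 / (real m - 1)\<^sup>2 * (real (m choose 2) * H) + 8 * \<theta>\<^sup>2 * (real m * V)"
    using S1(2) S2(2) by (intro add_mono mult_left_mono) auto
  also have "8 / (real m - 1)\<^sup>2 * (real (m choose 2) * H) = 4 * real m / (real m - 1) * H"
  proof -
    have *: "8 / d\<^sup>2 * (x * d / 2 * H) = 4 * x / d * H" if "d \<noteq> 0" for d x :: real
      using that by (simp add: field_simps power2_eq_square)
    show ?thesis unfolding real_choose_2 using m by (intro *) simp
  qed
  \<comment> \<open>m/(m - 1) \<le> 2 because m \<ge> 2.\<close>
  also have "\<dots> \<le> 8 * H"
    using m H0 by (intro mult_right_mono) (auto simp: divide_simps)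
  finally have ER: "expectation (\<lambda>\<omega>. (?R \<omega>)\<^sup>2) \<le> 8 * H + 8 * (real m * \<theta>\<^sup>2 * V)"
    by (simp add: mult_ac)
  have ae: "AE \<omega> in M. real m * ustat_limit \<omega> = - ?R \<omega> - real m * \<theta>\<^sup>2 * D"
  proof -
    have "AE \<omega> in M. \<forall>i\<in>{1..m}. h_post (X i \<omega>) = ?h1 (X i \<omega>) - \<theta> * v (X i \<omega>)"
    proof (intro AE_finite_allI finite_atLeastAtMost)
      fix i assume i: "i \<in> {1..m}"
      then have l: "distr M borel (X i) = P" by (simp add: lawP)
      have "AE x in distr M borel (X i). h_post x = ?h1 x - \<theta> * v x"
        unfolding l by (rule h_post)
      then show "AE \<omega> in M. h_post (X i \<omega>) = ?h1 (X i \<omega>) - \<theta> * v (X i \<omega>)"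
        using i by (intro AE_distrD[OF X_measurable]) auto
    qed
    then show ?thesis
    proof eventually_elim
      case (elim \<omega>)
      let ?U = "\<Sum>t\<in>ordered_pairs 0 m. h (X (fst t) \<omega>) (X (snd t) \<omega>)"
      let ?a = "\<Sum>i\<in>{1..m}. ?h1 (X i \<omega>)" and ?w = "\<Sum>i\<in>{1..m}. v (X i \<omega>)"
      have post: "(\<Sum>i\<in>{1..m}. h_post (X i \<omega>)) = ?a - \<theta> * ?w"
        using elim by (simp add: sum_subtractf sum_distrib_left)
      have "?S1 \<omega> = ?U - (\<Sum>t\<in>ordered_pairs 0 m. ?h1 (X (fst t) \<omega>) + ?h1 (X (snd t) \<omega>))
          + real (m choose 2) * ?\<mu>"
        using card_ordered_pairs[of 0 m]
        by (simp add: canonical_part_def sum.distrib sum_subtractf)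
      then have S1': "?S1 \<omega> = ?U - (real m - 1) * ?a + real m * (real m - 1) / 2 * ?\<mu>"
        unfolding sum_ordered_pairs_additive[of "\<lambda>i. ?h1 (X i \<omega>)"] real_choose_2 .
      have S2': "?S2 \<omega> = ?w - real m * ?e" by (simp add: sum_subtractf)
      have m1: "real m - 1 \<noteq> 0" "real m \<noteq> 0" using m by auto
      \<comment> \<open>The projections \<open>?a\<close> cancel between the mixed and the
        historical sum, and so do the means \<open>?\<mu>\<close>; the degenerate part, the centered
        linear part and the drift remain.\<close>
      show ?case
        unfolding ustat_limit_def post mean real_choose_2 S1' S2'
        using m1 by (simp add: field_simps)
    qed
  qed
  have "prob {\<omega> \<in> space M. real m * \<bar>ustat_limit \<omega>\<bar> \<le> K} \<le> prob {\<omega> \<in> space M. (?q - K)\<^sup>2 \<le> (?R \<omega>)\<^sup>2}"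
  proof (rule finite_measure_mono_AE)
    show "AE \<omega> in M. \<omega> \<in> {\<omega> \<in> space M. real m * \<bar>ustat_limit \<omega>\<bar> \<le> K}
        \<longrightarrow> \<omega> \<in> {\<omega> \<in> space M. (?q - K)\<^sup>2 \<le> (?R \<omega>)\<^sup>2}"
      using ae
    proof eventually_elim
      case (elim \<omega>)
      \<comment> \<open>If the limit is small, the fluctuation must compensate the drift, so its
        modulus is at least \<open>?q - K\<close>, which is positive by assumption.\<close>
      have "\<bar>real m * \<theta>\<^sup>2 * D\<bar> \<le> \<bar>?R \<omega>\<bar> + \<bar>real m * ustat_limit \<omega>\<bar>"
        unfolding elim by linarith
      then have "?q - real m * \<bar>ustat_limit \<omega>\<bar> \<le> \<bar>?R \<omega>\<bar>" by (simp add: abs_mult)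
      then have "(?q - K)\<^sup>2 \<le> (?R \<omega>)\<^sup>2" if "real m * \<bar>ustat_limit \<omega>\<bar> \<le> K"
        using K that by (intro iffD1[OF abs_le_square_iff]) linarith
      then show ?case by auto
    qed
  qed measurable
  also have "\<dots> \<le> expectation (\<lambda>\<omega>. (?R \<omega>)\<^sup>2) / (?q - K)\<^sup>2"
    using K by (intro integral_Markov_inequality_measure[where A="{}"] int_R2) auto
  also have "\<dots> \<le> (8 * H + 8 * (real m * \<theta>\<^sup>2 * V)) / (?q - K)\<^sup>2"
    using ER by (intro divide_right_mono) auto
  finally show ?thesis unfolding H_def V_def .
qed

end

section \<open>Kernel integrals under the mixture\<close>

text \<open>For \<open>N\<close>-almost every x the section of \<open>f\<close> is integrable under
  both components, hence under the mixture, and its absolute integral is the convex combination of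
  theirs. Fubini's criterion puts the sections together.\<close>

lemma integrable_pair_mixture:
  fixes f :: "'a::topological_space \<times> 'a \<Rightarrow> real"
  assumes N: "borel_prob N" and F: "borel_prob F" and G: "borel_prob G" and Q: "borel_prob Q"
    and mix: "is_mixture \<theta> G F Q" and \<theta>: "0 \<le> \<theta>" "\<theta> \<le> 1"
    and f [measurable]: "f \<in> borel_measurable (borel \<Otimes>\<^sub>M borel)"
    and int: "integrable (N \<Otimes>\<^sub>M F) f" "integrable (N \<Otimes>\<^sub>M G) f"
  shows "integrable (N \<Otimes>\<^sub>M Q) f"
proof -
  interpret N: prob_space N using N by (simp add: borel_prob_def)
  interpret F: prob_space F using F by (simp add: borel_prob_def)
  interpret G: prob_space G using G by (simp add: borel_prob_def)
  interpret Q: prob_space Q using Q by (simp add: borel_prob_def)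
  interpret NF: pair_prob_space N F ..
  interpret NG: pair_prob_space N G ..
  interpret NQ: pair_prob_space N Q ..
  have [measurable_cong]: "sets N = sets borel" "sets F = sets borel" "sets G = sets borel" "sets Q = sets borel"
    using N F G Q by (auto simp: borel_prob_def)
  note mix_int = integrable_mixture[OF F G Q mix \<theta>] integral_mixture[OF F G Q mix \<theta>]
  have ae: "AE x in N. integrable F (\<lambda>y. f (x, y)) \<and> integrable G (\<lambda>y. f (x, y))"
    using NF.AE_integrable_fst'[OF int(1)] NG.AE_integrable_fst'[OF int(2)] by eventually_elim simp
  show ?thesis
  proof (rule NQ.Fubini_integrable)
    show "AE x in N. integrable Q (\<lambda>y. f (x, y))"
      using ae by eventually_elim (simp add: mix_int(1))
    have 1: "integrable N (\<lambda>x. \<theta> * (\<integral>y. norm (f (x, y)) \<partial>G) + (1 - \<theta>) * (\<integral>y. norm (f (x, y)) \<partial>F))"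
      using NF.integrable_fst'[OF integrable_norm[OF int(1)]] NG.integrable_fst'[OF integrable_norm[OF int(2)]]
      by (intro Bochner_Integration.integrable_add integrable_mult_right)
    have 2: "AE x in N. \<theta> * (\<integral>y. norm (f (x, y)) \<partial>G) + (1 - \<theta>) * (\<integral>y. norm (f (x, y)) \<partial>F) =
        (\<integral>y. norm (f (x, y)) \<partial>Q)"
      using ae by eventually_elim (simp add: mix_int(2))
    show "integrable N (\<lambda>x. \<integral>y. norm (f (x, y)) \<partial>Q)"
      by (rule integrable_cong_AE_imp[OF 1 _ 2]) measurable
  qed measurable
qed

lemma integrable_pair_swap:
  fixes h :: "'a::topological_space \<Rightarrow> 'a \<Rightarrow> real"
  assumes "borel_prob A" "borel_prob B" and sym: "\<And>x y. h x y = h y x"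
    and int: "integrable (A \<Otimes>\<^sub>M B) (case_prod h)"
  shows "integrable (B \<Otimes>\<^sub>M A) (case_prod h)"
proof -
  interpret A: prob_space A using assms by (simp add: borel_prob_def)
  interpret B: prob_space B using assms by (simp add: borel_prob_def)
  interpret AB: pair_prob_space A B ..
  show ?thesis using AB.integrable_product_swap[OF int] sym by simp
qed

text \<open>Q = F - \<theta>(F - G). Integrating one argument of \<open>h\<close> against this gives
  the section identity; integrating both gives, by bilinearity and symmetry, the mean with its
  linear term and the quadratic drift.\<close>

lemma
  fixes h :: "'a::topological_space \<Rightarrow> 'a \<Rightarrow> real"
  assumes F: "borel_prob F" and G: "borel_prob G" and Q: "borel_prob Q"
    and mix: "is_mixture \<theta> G F Q" and \<theta>: "0 \<le> \<theta>" "\<theta> \<le> 1"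
    and h [measurable]: "case_prod h \<in> borel_measurable (borel \<Otimes>\<^sub>M borel)"
    and sym: "\<And>x y. h x y = h y x"
    and int: "integrable (F \<Otimes>\<^sub>M F) (case_prod h)" "integrable (F \<Otimes>\<^sub>M G) (case_prod h)"
      "integrable (G \<Otimes>\<^sub>M G) (case_prod h)"
  shows integrable_kernel_F_mixture: "integrable (F \<Otimes>\<^sub>M Q) (case_prod h)"
    and integrable_kernel_mixture: "integrable (Q \<Otimes>\<^sub>M Q) (case_prod h)"
    and kernel_mixture_AE: "AE x in F. (\<integral>y. h x y \<partial>Q) = (\<integral>y. h x y \<partial>F) - \<theta> * kernel_proj h F G x"
    and kernel_mixture_mean: "(\<integral>z. case_prod h z \<partial>(Q \<Otimes>\<^sub>M Q)) = (\<integral>z. case_prod h z \<partial>(F \<Otimes>\<^sub>M F))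
      - 2 * \<theta> * (\<integral>x. kernel_proj h F G x \<partial>F) + \<theta>\<^sup>2 * kernel_dist h F G"
proof -
  interpret F: prob_space F using F by (simp add: borel_prob_def)
  interpret G: prob_space G using G by (simp add: borel_prob_def)
  interpret Q: prob_space Q using Q by (simp add: borel_prob_def)
  interpret FF: pair_prob_space F F ..
  interpret FG: pair_prob_space F G ..
  interpret GF: pair_prob_space G F ..
  interpret GG: pair_prob_space G G ..
  interpret QQ: pair_prob_space Q Q ..
  have [measurable_cong]: "sets F = sets borel" "sets G = sets borel" "sets Q = sets borel"
    using F G Q by (auto simp: borel_prob_def)
  note swap = integrable_pair_swap[OF _ _ sym]
  note pair = integrable_pair_mixture[OF _ F G Q mix \<theta> h]
  note mix_int = integrable_mixture[OF F G Q mix \<theta>] integral_mixture[OF F G Q mix \<theta>]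
  have GF: "integrable (G \<Otimes>\<^sub>M F) (case_prod h)" by (rule swap[OF F G int(2)])
  show FQ: "integrable (F \<Otimes>\<^sub>M Q) (case_prod h)" by (rule pair[OF F int(1,2)])
  have "integrable (G \<Otimes>\<^sub>M Q) (case_prod h)" by (rule pair[OF G GF int(3)])
  \<comment> \<open>\<open>pair\<close> treats a mixture in the second coordinate; the swaps supply
    \<open>Q\<close> in the first one.\<close>
  then show QQ: "integrable (Q \<Otimes>\<^sub>M Q) (case_prod h)"
    by (intro pair[OF Q] swap[OF F Q FQ] swap[OF G Q])
  let ?h1 = "\<lambda>x. \<integral>y. h x y \<partial>F" and ?g1 = "\<lambda>x. \<integral>y. h x y \<partial>G" and ?hQ = "\<lambda>x. \<integral>y. h x y \<partial>Q"
  let ?v = "kernel_proj h F G"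
  have v: "?v x = ?h1 x - ?g1 x" for x by (simp add: kernel_proj_def diff_integral_def)
  have point: "?hQ x = ?h1 x - \<theta> * ?v x" if "integrable F (h x)" "integrable G (h x)" for x
    using mix_int(2)[OF that] by (simp add: v algebra_simps)
  show aeF: "AE x in F. ?hQ x = ?h1 x - \<theta> * ?v x"
    using FF.AE_integrable_fst'[OF int(1)] FG.AE_integrable_fst'[OF int(2)]
    by eventually_elim (simp add: point)
  have aeG: "AE x in G. ?hQ x = ?h1 x - \<theta> * ?v x"
    using GF.AE_integrable_fst'[OF GF] GG.AE_integrable_fst'[OF int(3)]
    by eventually_elim (simp add: point)
  have i: "integrable F ?h1" "integrable F ?g1" "integrable G ?h1" "integrable G ?g1"
    using FF.integrable_fst'[OF int(1)] FG.integrable_fst'[OF int(2)]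
      GF.integrable_fst'[OF GF] GG.integrable_fst'[OF int(3)] by simp_all
  have iv: "integrable F ?v" "integrable G ?v" using i by (simp_all add: v[abs_def])
  have [measurable]: "?v \<in> borel_measurable borel" by (simp add: v[abs_def])
  have \<mu>: "(\<integral>z. case_prod h z \<partial>(F \<Otimes>\<^sub>M F)) = (\<integral>x. ?h1 x \<partial>F)"
    using FF.integral_fst'[OF int(1)] by simp
  have cross: "(\<integral>x. ?h1 x \<partial>G) = (\<integral>x. ?g1 x \<partial>F)"
    using FG.Fubini_integral[OF int(2)] sym by simp
  have D: "kernel_dist h F G = (\<integral>x. ?v x \<partial>F) - (\<integral>x. ?v x \<partial>G)"
    unfolding kernel_dist_def diff_integral_def v using sym by simp
  have "(\<integral>z. case_prod h z \<partial>(Q \<Otimes>\<^sub>M Q)) = (\<integral>x. ?hQ x \<partial>Q)"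
    using QQ.integral_fst'[OF QQ] by simp
  \<comment> \<open>The section identity holds almost everywhere under \<open>F\<close> and under
    \<open>G\<close>, hence under the mixture.\<close>
  also have "\<dots> = (\<integral>x. ?h1 x - \<theta> * ?v x \<partial>Q)"
    by (rule integral_cong_AE) (use AE_mixture[OF F G Q mix aeF aeG] in measurable)
  also have "\<dots> = \<theta> * (\<integral>x. ?h1 x - \<theta> * ?v x \<partial>G) + (1 - \<theta>) * (\<integral>x. ?h1 x - \<theta> * ?v x \<partial>F)"
    using i iv by (intro mix_int(2)) auto
  also have "\<dots> = \<theta> * ((\<integral>x. ?h1 x \<partial>G) - \<theta> * (\<integral>x. ?v x \<partial>G))
      + (1 - \<theta>) * ((\<integral>x. ?h1 x \<partial>F) - \<theta> * (\<integral>x. ?v x \<partial>F))"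
    using i iv by simp
  \<comment> \<open>By \<open>cross\<close> this is the \<open>F\<close>-mean of \<open>?g1\<close>,
    that is, of \<open>?h1\<close> minus \<open>?v\<close>. It supplies the second copy of the
    linear term, whence the factor 2.\<close>
  also have "(\<integral>x. ?h1 x \<partial>G) = (\<integral>x. ?h1 x \<partial>F) - (\<integral>x. ?v x \<partial>F)"
    using i by (simp add: v cross)
  finally show "(\<integral>z. case_prod h z \<partial>(Q \<Otimes>\<^sub>M Q)) = (\<integral>z. case_prod h z \<partial>(F \<Otimes>\<^sub>M F))
      - 2 * \<theta> * (\<integral>x. ?v x \<partial>F) + \<theta>\<^sup>2 * kernel_dist h F G"
    unfolding D \<mu> by (simp add: algebra_simps power2_eq_square)
qed

section \<open>Passage to the limit in the training size\<close>

theorem theorem3p3: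
  fixes h :: "'a::metric_space \<Rightarrow> 'a \<Rightarrow> real"
    and F :: "'a measure"
    and G Fs :: "nat \<Rightarrow> 'a measure"
    and M :: "nat \<Rightarrow> 'w measure"
    and X :: "nat \<Rightarrow> nat \<Rightarrow> 'w \<Rightarrow> 'a"
    and kst :: "nat \<Rightarrow> nat"
    and \<theta> :: "nat \<Rightarrow> real"
    and \<beta> c \<zeta> \<zeta>s :: real
    and detector :: "('a \<Rightarrow> 'a \<Rightarrow> real) \<Rightarrow> (nat \<Rightarrow> 'a) \<Rightarrow> nat \<Rightarrow> nat \<Rightarrow> real"
  assumes separable: "separable_space (euclidean :: 'a topology)"
    and h_meas: "(\<lambda>(x, y). h x y) \<in> borel_measurable (borel \<Otimes>\<^sub>M borel)"
    and h_sym: "\<And>x y. h x y = h y x"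
    and F: "borel_prob F"
    and h_sq: "integrable (F \<Otimes>\<^sub>M F) (\<lambda>(x, y). (h x y)\<^sup>2)"
    and G: "\<And>m. m \<ge> 2 \<Longrightarrow> borel_prob (G m)"
    and Fs: "\<And>m. m \<ge> 2 \<Longrightarrow> borel_prob (Fs m)"
    and \<theta>: "\<And>m. m \<ge> 2 \<Longrightarrow> 0 < \<theta> m \<and> \<theta> m < 1"
    and mixture: "\<And>m. m \<ge> 2 \<Longrightarrow> is_mixture (\<theta> m) (G m) F (Fs m)"
    and h_int_FG: "\<And>m. m \<ge> 2 \<Longrightarrow> integrable (F \<Otimes>\<^sub>M G m) (\<lambda>(x, y). h x y)"
    and h_int_GG: "\<And>m. m \<ge> 2 \<Longrightarrow> integrable (G m \<Otimes>\<^sub>M G m) (\<lambda>(x, y). h x y)"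
    and v_sq_F: "\<And>m. m \<ge> 2 \<Longrightarrow> integrable F (\<lambda>x. (kernel_proj h F (G m) x)\<^sup>2)"
    and v_sq_Fs: "\<And>m. m \<ge> 2 \<Longrightarrow> integrable (Fs m) (\<lambda>x. (kernel_proj h F (G m) x)\<^sup>2)"
    and HA: "\<And>m. m \<ge> 2 \<Longrightarrow> change_model (M m) (X m) m (kst m) F (Fs m)"
    and dist_lim: "filterlim (\<lambda>m. real m * (\<theta> m)\<^sup>2 * \<bar>kernel_dist h F (G m)\<bar>) at_top sequentially"
    and \<sigma>_lim: "(\<lambda>m. sqrt (prob_space.variance F (kernel_proj h F (G m)))
                   * \<bar>kernel_dist h F (G m)\<bar> powr (-1/2)) \<longlonglongrightarrow> \<zeta>"
    and \<sigma>s_lim: "(\<lambda>m. sqrt (prob_space.variance (Fs m) (kernel_proj h F (G m)))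
                   * \<bar>kernel_dist h F (G m)\<bar> powr (-1/2)) \<longlonglongrightarrow> \<zeta>s"
    and \<zeta>: "\<zeta> > 0" "\<zeta>s > 0"
    and \<beta>: "0 \<le> \<beta>" "\<beta> < 1"
    and c: "c > 0"
    and detector: "detector \<in> {detector1, detector2}"
  shows "(\<lambda>m. measure (M m) {\<omega> \<in> space (M m).
            stop_time c \<beta> m (\<lambda>k. detector h (\<lambda>i. X m i \<omega>) m k) < \<infinity>}) \<longlonglongrightarrow> 1"
proof -
  have h [measurable]: "case_prod h \<in> borel_measurable (borel \<Otimes>\<^sub>M borel)" using h_meas .
  have h_FF: "integrable (F \<Otimes>\<^sub>M F) (case_prod h)"
    by (rule integrable_of_integrable_sq[OF F h h_sq])
  let ?D = "\<lambda>m. kernel_dist h F (G m)" and ?v = "\<lambda>m. kernel_proj h F (G m)"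
  let ?q = "\<lambda>m. real m * (\<theta> m)\<^sup>2 * \<bar>?D m\<bar>"
  let ?V = "\<lambda>m. prob_space.variance F (?v m)"
  let ?S = "\<lambda>m. {\<omega> \<in> space (M m). stop_time c \<beta> m (\<lambda>k. detector h (\<lambda>i. X m i \<omega>) m k) < \<infinity>}"
  define K where "K = 4 * c + 1"
  \<comment> \<open>Free of m, because \<open>F\<close> and the kernel are fixed.\<close>
  define H where "H = (\<integral>(x, y). (canonical_part F h x y)\<^sup>2 \<partial>(F \<Otimes>\<^sub>M F))"
  \<comment> \<open>A number above \<zeta>^2, the limit of the variance divided by |D|.\<close>
  define W where "W = \<zeta>\<^sup>2 + 1"
  have prob_M: "prob_space (M m)" if "2 \<le> m" for m
    using HA[OF that] by (simp add: change_model_def)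
  have bound: "1 - (8 * H + 8 * (real m * (\<theta> m)\<^sup>2 * ?V m)) / (?q m - K)\<^sup>2 \<le> measure (M m) (?S m)"
    if m: "2 \<le> m" and K: "K < ?q m" for m
  proof -
    note \<theta>m = \<theta>[OF m, THEN conjunct1, THEN less_imp_le] \<theta>[OF m, THEN conjunct2, THEN less_imp_le]
    have FG: "integrable (F \<Otimes>\<^sub>M G m) (case_prod h)" and GG: "integrable (G m \<Otimes>\<^sub>M G m) (case_prod h)"
      using h_int_FG[OF m] h_int_GG[OF m] by auto
    note mix = F G[OF m] Fs[OF m] mixture[OF m] \<theta>m h h_sym h_FF FG GG
    have cm: "change_model (M m) (X m) m (kst m) F (Fs m)" using HA[OF m] .
    interpret prob_space "M m" by (rule prob_M[OF m])
    interpret change_point "M m" "X m" m "kst m" F "Fs m" h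
    proof unfold_locales
      show "indep_vars (\<lambda>_. borel) (X m) {1..}" using cm by (simp add: change_model_def)
      show "distr (M m) borel (X m i) = F" if "1 \<le> i" "i \<le> m + kst m" for i
      proof (cases "i \<le> m")
        case True
        then show ?thesis using cm that by (simp add: change_model_def)
      next
        case False
        then have "1 \<le> i - m" "i - m \<le> kst m" "m + (i - m) = i" using that by auto
        then show ?thesis using cm unfolding change_model_def by metis
      qed
      show "distr (M m) borel (X m i) = Fs m" if "m + kst m < i" for i
      proof -
        have "kst m + 1 \<le> i - m" "m + (i - m) = i" using that by auto
        then show ?thesis using cm unfolding change_model_def by metis
      qed
    qed (use m h h_FF integrable_kernel_F_mixture[OF mix] integrable_kernel_mixture[OF mix] in auto)
    have v_meas: "?v m \<in> borel_measurable borel"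
    proof -
      have [measurable_cong]: "sets F = sets borel" "sets (G m) = sets borel"
        using F G[OF m] by (auto simp: borel_prob_def)
      interpret F: prob_space F using F by (simp add: borel_prob_def)
      interpret G: prob_space "G m" using G[OF m] by (simp add: borel_prob_def)
      show ?thesis unfolding kernel_proj_def diff_integral_def by measurable
    qed
    have "prob {\<omega> \<in> space (M m). real m * \<bar>ustat_limit \<omega>\<bar> \<le> K} \<le>
        (8 * H + 8 * (real m * (\<theta> m)\<^sup>2 * ?V m)) / (?q m - K)\<^sup>2"
      unfolding H_def
      using kernel_mixture_AE[OF mix] kernel_mixture_mean[OF mix]
      by (intro ustat_limit_small_probability m h_sym h_sq v_meas v_sq_F K) (simp_all add: h_post_def)
    with detection_probability[OF \<beta>(1) c detector] show ?thesis
      unfolding K_def by linarith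
  qed
  have q_lim: "filterlim ?q at_top sequentially" using dist_lim .
  have "(\<lambda>m. (sqrt (?V m) * \<bar>?D m\<bar> powr (-1/2))\<^sup>2) \<longlonglongrightarrow> \<zeta>\<^sup>2"
    by (intro tendsto_power \<sigma>_lim)
  then have "\<forall>\<^sub>F m in sequentially. (sqrt (?V m) * \<bar>?D m\<bar> powr (-1/2))\<^sup>2 < W"
    by (rule order_tendstoD(2)) (simp add: W_def)
  \<comment> \<open>Positivity of \<open>?q m\<close> forces D \<noteq> 0. At D = 0 the
    \<open>powr\<close> factor would be 0 by convention and the ratio would say nothing about the
    variance.\<close>
  moreover have "\<forall>\<^sub>F m in sequentially. max K 0 < ?q m"
    using q_lim by (simp only: filterlim_at_top_dense)
  ultimately have "\<forall>\<^sub>F m in sequentially.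
      1 - (8 * H + 8 * (W * ?q m)) / (?q m - K)\<^sup>2 \<le> measure (M m) (?S m) \<and> measure (M m) (?S m) \<le> 1"
    using eventually_ge_at_top[of 2]
  proof eventually_elim
    case (elim m)
    interpret F: prob_space F using F by (simp add: borel_prob_def)
    have D: "0 < \<bar>?D m\<bar>" using elim(2) by (cases "?D m = 0") auto
    have V0: "0 \<le> ?V m" by (rule F.variance_positive)
    have "(\<bar>?D m\<bar> powr (-1/2))\<^sup>2 = 1 / \<bar>?D m\<bar>"
      using D by (simp add: powr_minus_divide powr_half_sqrt power_divide)
    then have "?V m / \<bar>?D m\<bar> < W"
      using elim(1) V0 by (simp add: power_mult_distrib)
    then have "?V m \<le> W * \<bar>?D m\<bar>" using D by (simp add: divide_simps split: if_splits)
    then have "real m * (\<theta> m)\<^sup>2 * ?V m \<le> real m * (\<theta> m)\<^sup>2 * (W * \<bar>?D m\<bar>)"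
      by (intro mult_left_mono) auto
    then have "(8 * H + 8 * (real m * (\<theta> m)\<^sup>2 * ?V m)) / (?q m - K)\<^sup>2 \<le> (8 * H + 8 * (W * ?q m)) / (?q m - K)\<^sup>2"
      by (intro divide_right_mono) (auto simp: mult_ac)
    moreover have "1 - (8 * H + 8 * (real m * (\<theta> m)\<^sup>2 * ?V m)) / (?q m - K)\<^sup>2 \<le> measure (M m) (?S m)"
      using elim by (intro bound) auto
    moreover have "measure (M m) (?S m) \<le> 1"
      using prob_M[OF elim(3)] by (rule prob_space.prob_le_1)
    ultimately show ?case by linarith
  qed
  then have lower: "\<forall>\<^sub>F m in sequentially. 1 - (8 * H + 8 * (W * ?q m)) / (?q m - K)\<^sup>2 \<le> measure (M m) (?S m)"
    and upper: "\<forall>\<^sub>F m in sequentially. measure (M m) (?S m) \<le> 1"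
    by (auto elim: eventually_mono)
  \<comment> \<open>The error is linear in q over quadratic in q.\<close>
  have "((\<lambda>q. 1 - (8 * H + 8 * (W * q)) / (q - K)\<^sup>2) \<longlongrightarrow> 1) at_top"
    by real_asymp
  then have "(\<lambda>m. 1 - (8 * H + 8 * (W * ?q m)) / (?q m - K)\<^sup>2) \<longlonglongrightarrow> 1"
    using q_lim by (rule filterlim_compose)
  then show ?thesis
    by (rule tendsto_sandwich[OF lower upper _ tendsto_const])
qed

end
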